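(* Let $M>0$, $H\in\mathbb{R}$, $c_1<-8M^3H$, $\bar c_1\in\mathbb{R}$. Take $r_1>2M$ with $r_1+2M\ln|r_1-2M|=0$ as the base point in the definition of $f_1$, and denote $\bar f'(r)=f_1'(r)+\frac1{h(r)}$, which can be expressed as $$\bar f'(r)=\frac{r^4}{(Hr^3+c_1)^2+r^3(r-2M)-(Hr^3+c_1)\sqrt{(Hr^3+c_1)^2+r^3(r-2M)}}$$ (this expression is also used to define $\bar f'$ for $r\le 2M$). Suppose that $\Sigma^1_{H,c_1,\bar c_1}$ in region I connects smoothly with $\Sigma^2_{H,c_1,\bar c_2}$ in region II. Then $$\bar c_2=\bar c_1-\int_{r_2}^{r_1}\bar f'(r)\,\mathrm{d}r-(r_2+2M\ln|r_2-2M|),$$ where $r_2<2M$ is the base point of $f_2^*$, lying in the domain of $f_2^*$. Suppose moreover that $c_H<c_1<-8M^3H$, where $c_H=\min_{r\in(0,2M)}\left(-Hr^3-r^{3/2}(2M-r)^{1/2}\right)$, so that $f_2^*$ and $f_2^{**}$ are defined on an interval $[r'',2M)$, and that $\Sigma^2_{H,c_1,\bar c_2}$ connects smoothly with $\Sigma^3_{H,c_1,\bar c_3}$ in region I$'$. If one takes $r_2=r_2'=r''$, $\bar c_2'=\bar c_2$ and $r_3=r_1$, then $$\bar c_3=\bar c_2-\int_{r''}^{r_3}\bar f'(r)\,\mathrm{d}r-(r''+2M\ln|r''-2M|)=\bar c_1-2\int_{r''}^{r_1}\bar f'(r)\,\mathrm{d}r-2(r''+2M\ln|r''-2M|).$$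
   Context: Kruskal extension: for $M>0$ and $h(r)=1-\frac{2M}{r}$, it is the manifold $\{(U,V)\in\mathbb{R}^2: UV>-2M\}\times\mathbb{S}^2$ with metric $\mathrm{d}s^2=\frac{16M^2e^{-r/2M}}{r}\,\mathrm{d}U\,\mathrm{d}V+r^2(\mathrm{d}\theta^2+\sin^2\theta\,\mathrm{d}\phi^2)$, where $r>0$ is determined by $(r-2M)e^{r/2M}=UV$. With $X=\frac{V+U}2$, $T=\frac{V-U}2$, $\partial_T$ is taken to be future directed. Regions: I $=\{U>0,V>0\}$, II $=\{U<0,V>0\}$, I$'=\{U<0,V<0\}$, II$'=\{U>0,V<0\}$. In each region one uses coordinates $(t,r,\theta,\phi)$ with $t=2M\ln|V/U|$; equivalently, with $u=t-(r+2M\ln|r-2M|)$, $v=t+(r+2M\ln|r-2M|)$, one has $|U|=e^{-u/4M}$, $|V|=e^{v/4M}$. In these coordinates $\mathrm{d}s^2=-h\,\mathrm{d}t^2+h^{-1}\mathrm{d}r^2+r^2(\mathrm{d}\theta^2+\sin^2\theta\,\mathrm{d}\phi^2)$; regions I, I$'$ correspond to $r>2M$ and II, II$'$ to $0<r<2M$. $\Sigma^1_{H,c,\bar c_1}$ is the hypersurface $t=f_1(r)$, $r>2M$, in region I with $f_1(r)=\int_{r_1}^r\frac{l_1(x)}{h(x)}\frac{\mathrm{d}x}{\sqrt{1+l_1(x)^2}}+\bar c_1$, $l_1(r)=\frac1{\sqrt{h(r)}}\left(Hr+\frac{c}{r^2}\right)$. $\Sigma^3_{H,c,\bar c_3}$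 is the hypersurface $t=f_3(r)$, $r>2M$, in region I$'$ with $f_3(r)=\int_{r_3}^r\frac{l_3(x)}{h(x)}\frac{\mathrm{d}x}{\sqrt{1+l_3(x)^2}}+\bar c_3$, $l_3=-l_1$. In region II, let $l_2(r)=\frac1{\sqrt{-h(r)}}\left(-Hr-\frac{c}{r^2}\right)$ and $f_2^*(r)=\int_{r_2}^r\frac1{-h(x)}\sqrt{\frac{l_2(x)^2}{l_2(x)^2-1}}\,\mathrm{d}x+\bar c_2$, $f_2^{**}(r)=\int_{r_2'}^r\frac1{h(x)}\sqrt{\frac{l_2(x)^2}{l_2(x)^2-1}}\,\mathrm{d}x+\bar c_2'$, defined where $l_2>1$, equivalently $k_H(r):=-Hr^3-r^{3/2}(2M-r)^{1/2}>c$, and also at points with $k_H(r)=c$ at which the integral is finite. Let $r_H$ be the unique minimum point of $k_H$ on $(0,2M)$ and $c_H=k_H(r_H)<-8M^3H$. For $c<c_H$ the domain is $(0,2M)$; for $c=c_H$ the relevant component of the domain is $(r_H,2M)$; in these cases $\Sigma^2_{H,c,\bar c_2}$ is the hypersurface $t=f_2^*(r)$ in region II over that interval. For $c_H<c<-8M^3H$ the relevant component of the domain is $[r'',2M)$ with $k_H(r'')=c$, and $\Sigma^2_{H,c,\bar c_2}$ is the union of the hypersurfaces $t=f_2^*(r)$ and $t=f_2^{**}(r)$ over $[r'',2M)$ (matching at $r''$). These are spacelike spherically symmetric hypersurfaces of constant mean curvature $H$. Two such hypersurfaces in adjacent regions connect smoothly if their union, together with the limiting 2-sphere on the common boundary $r=2M$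 of the two regions, is a smooth spacelike hypersurface in the Kruskal extension (regions I and II meet along $\{U=0,V>0\}$; II and I$'$ along $\{V=0,U<0\}$). *)

theory Defs
  imports "HOL-Analysis.Analysis"
begin

section \<open>Smooth maps and embedded three-dimensional submanifolds\<close>

fun C_k_on :: "nat \<Rightarrow> 'a::euclidean_space set \<Rightarrow> ('a \<Rightarrow> 'b::real_normed_vector) \<Rightarrow> bool" where
  "C_k_on 0 A f \<longleftrightarrow> continuous_on A f"
| "C_k_on (Suc k) A f \<longleftrightarrow>
     (\<forall>x\<in>A. f differentiable (at x)) \<and>
     (\<forall>v. C_k_on k A (\<lambda>x. frechet_derivative f (at x) v))"

text \<open>Only used for open sets, where \<^term>\<open>at x\<close> and \<open>at x within A\<close> agree.\<close>

definition smooth_on :: "'a::euclidean_space set \<Rightarrow> ('a \<Rightarrow> 'b::real_normed_vector) \<Rightarrow> bool" where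
  "smooth_on A f \<longleftrightarrow> (\<forall>k. C_k_on k A f)"

text \<open>The Kruskal manifold is embedded in \<open>\<real>\<^sup>2 \<times> \<real>\<^sup>3\<close>; a point is \<open>((U, V), \<omega>)\<close> with
  \<open>\<omega>\<close> in the unit sphere of \<open>\<real>\<^sup>3\<close>. The Kruskal manifold has dimension four, so a hypersurface
  in it is locally parametrised by open subsets of \<open>\<real>\<^sup>3\<close>.\<close>

type_synonym point = "(real \<times> real) \<times> (real ^ 3)"

definition local_param :: "point set \<Rightarrow> (real ^ 3) set \<Rightarrow> (real ^ 3 \<Rightarrow> point) \<Rightarrow> bool" where
  "local_param S A \<phi> \<longleftrightarrow>
     open A \<and> smooth_on A \<phi> \<and>
     (\<forall>a\<in>A. inj (frechet_derivative \<phi> (at a))) \<and>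
     (\<exists>\<psi>. homeomorphism A (\<phi> ` A) \<phi> \<psi>) \<and>
     (\<exists>W. open W \<and> \<phi> ` A = S \<inter> W)"


section \<open>The Kruskal extension\<close>

definition kruskal :: "real \<Rightarrow> point set" where
  "kruskal M = {(U, V). U * V > - 2 * M} \<times> sphere 0 1"

definition h :: "real \<Rightarrow> real \<Rightarrow> real" where
  "h M r = 1 - 2 * M / r"

definition r_of :: "real \<Rightarrow> real \<times> real \<Rightarrow> real" where
  "r_of M = (\<lambda>(U, V). THE r. r > 0 \<and> (r - 2 * M) * exp (r / (2 * M)) = U * V)"

definition t_of :: "real \<Rightarrow> real \<times> real \<Rightarrow> real" where
  "t_of M = (\<lambda>(U, V). 2 * M * ln \<bar>V / U\<bar>)"

text \<open>\<open>dU dV\<close> is the symmetrised product, i.e. half of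
  \<open>dU \<otimes> dV + dV \<otimes> dU\<close>. The round metric of the unit sphere is the one induced
  from \<open>\<real>\<^sup>3\<close>.\<close>

definition kruskal_metric :: "real \<Rightarrow> point \<Rightarrow> point \<Rightarrow> point \<Rightarrow> real" where
  "kruskal_metric M p \<xi> \<eta> =
     (let r = r_of M (fst p) in
        16 * M\<^sup>2 * exp (- r / (2 * M)) / r *
          ((fst (fst \<xi>) * snd (fst \<eta>) + snd (fst \<xi>) * fst (fst \<eta>)) / 2)
        + r\<^sup>2 * (snd \<xi> \<bullet> snd \<eta>))"

definition smooth_hypersurface :: "real \<Rightarrow> point set \<Rightarrow> bool" where
  "smooth_hypersurface M S \<longleftrightarrow>
     S \<subseteq> kruskal M \<and> (\<forall>p\<in>S. \<exists>A \<phi>. local_param S A \<phi> \<and> p \<in> \<phi> ` A)"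

text \<open>The tangent space of \<open>S\<close> at \<open>\<phi> a\<close> is the range of the derivative of \<open>\<phi>\<close> at \<open>a\<close>.\<close>

definition spacelike :: "real \<Rightarrow> point set \<Rightarrow> bool" where
  "spacelike M S \<longleftrightarrow>
     (\<forall>A \<phi>. local_param S A \<phi> \<longrightarrow>
        (\<forall>a\<in>A. \<forall>\<xi>\<in>range (frechet_derivative \<phi> (at a)).
           \<xi> \<noteq> 0 \<longrightarrow> kruskal_metric M (\<phi> a) \<xi> \<xi> > 0))"

definition region_I :: "(real \<times> real) set" where
  "region_I = {(U, V). U > 0 \<and> V > 0}"

definition region_II :: "(real \<times> real) set" where
  "region_II = {(U, V). U < 0 \<and> V > 0}"

definition region_I' :: "(real \<times> real) set" where
  "region_I' = {(U, V). U < 0 \<and> V < 0}"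

definition horizon_I_II :: "(real \<times> real) set" where
  "horizon_I_II = {(U, V). U = 0 \<and> V > 0}"

definition horizon_II_I' :: "(real \<times> real) set" where
  "horizon_II_I' = {(U, V). V = 0 \<and> U < 0}"

text \<open>The hypersurface \<open>t = f(r)\<close>, \<open>r \<in> J\<close>, in the region \<open>Q\<close>.\<close>

definition graph_in :: "real \<Rightarrow> (real \<times> real) set \<Rightarrow> real set \<Rightarrow> (real \<Rightarrow> real) \<Rightarrow> point set" where
  "graph_in M Q J f =
     {(q, \<omega>) \<in> kruskal M. q \<in> Q \<and> r_of M q \<in> J \<and> t_of M q = f (r_of M q)}"

text \<open>The limiting 2-sphere is the spherically symmetric sphere over a point \<open>P\<close> of the common
  boundary \<open>B\<close>. It is only required to consist of limit points of the union; that
  it is approached from both sides is not assumed.\<close>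

definition connects_smoothly ::
    "real \<Rightarrow> (real \<times> real) set \<Rightarrow> point set \<Rightarrow> point set \<Rightarrow> bool" where
  "connects_smoothly M B S S' \<longleftrightarrow>
     (\<exists>P\<in>B. {P} \<times> sphere 0 1 \<subseteq> closure (S \<union> S') \<and>
        smooth_hypersurface M (S \<union> S' \<union> {P} \<times> sphere 0 1) \<and>
        spacelike M (S \<union> S' \<union> {P} \<times> sphere 0 1))"


section \<open>The constant mean curvature hypersurfaces\<close>

text \<open>In all height functions \<open>b\<close> is the base point of the integral and \<open>k\<close> the additive constant.
  The integrals are oriented (the base point may lie on either side of the argument) and
  may be improper at an end point.\<close>

definition l1 :: "real \<Rightarrow> real \<Rightarrow> real \<Rightarrow> real \<Rightarrow> real" where
  "l1 M H c r = 1 / sqrt (h M r) * (H * r + c / r\<^sup>2)"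

definition f1 :: "real \<Rightarrow> real \<Rightarrow> real \<Rightarrow> real \<Rightarrow> real \<Rightarrow> real \<Rightarrow> real" where
  "f1 M H c b k r =
     (LBINT x=b..r. l1 M H c x / h M x * (1 / sqrt (1 + (l1 M H c x)\<^sup>2))) + k"

definition \<Sigma>1 :: "real \<Rightarrow> real \<Rightarrow> real \<Rightarrow> real \<Rightarrow> real \<Rightarrow> point set" where
  "\<Sigma>1 M H c b k = graph_in M region_I {2 * M<..} (f1 M H c b k)"

definition l3 :: "real \<Rightarrow> real \<Rightarrow> real \<Rightarrow> real \<Rightarrow> real" where
  "l3 M H c r = - l1 M H c r"

definition f3 :: "real \<Rightarrow> real \<Rightarrow> real \<Rightarrow> real \<Rightarrow> real \<Rightarrow> real \<Rightarrow> real" where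
  "f3 M H c b k r =
     (LBINT x=b..r. l3 M H c x / h M x * (1 / sqrt (1 + (l3 M H c x)\<^sup>2))) + k"

definition \<Sigma>3 :: "real \<Rightarrow> real \<Rightarrow> real \<Rightarrow> real \<Rightarrow> real \<Rightarrow> point set" where
  "\<Sigma>3 M H c b k = graph_in M region_I' {2 * M<..} (f3 M H c b k)"

definition l2 :: "real \<Rightarrow> real \<Rightarrow> real \<Rightarrow> real \<Rightarrow> real" where
  "l2 M H c r = 1 / sqrt (- h M r) * (- H * r - c / r\<^sup>2)"

definition f2_star :: "real \<Rightarrow> real \<Rightarrow> real \<Rightarrow> real \<Rightarrow> real \<Rightarrow> real \<Rightarrow> real" where
  "f2_star M H c b k r =
     (LBINT x=b..r. 1 / (- h M x) * sqrt ((l2 M H c x)\<^sup>2 / ((l2 M H c x)\<^sup>2 - 1))) + k"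

definition f2_star2 :: "real \<Rightarrow> real \<Rightarrow> real \<Rightarrow> real \<Rightarrow> real \<Rightarrow> real \<Rightarrow> real" where
  "f2_star2 M H c b k r =
     (LBINT x=b..r. 1 / h M x * sqrt ((l2 M H c x)\<^sup>2 / ((l2 M H c x)\<^sup>2 - 1))) + k"

definition kH :: "real \<Rightarrow> real \<Rightarrow> real \<Rightarrow> real" where
  "kH M H r = - H * r ^ 3 - r powr (3 / 2) * (2 * M - r) powr (1 / 2)"

definition rH :: "real \<Rightarrow> real \<Rightarrow> real" where
  "rH M H = (THE r. r \<in> {0<..<2 * M} \<and> (\<forall>s\<in>{0<..<2 * M}. kH M H r \<le> kH M H s))"

definition cH :: "real \<Rightarrow> real \<Rightarrow> real" where
  "cH M H = kH M H (rH M H)"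

text \<open>The left end point \<open>r''\<close> of the component of \<open>{r. kH M H r \<ge> c}\<close> adjacent to \<open>2M\<close>;
  meaningful for \<open>cH M H < c < - 8 M\<^sup>3 H\<close>.\<close>

definition r_turn :: "real \<Rightarrow> real \<Rightarrow> real \<Rightarrow> real" where
  "r_turn M H c =
     (THE r. r \<in> {0<..<2 * M} \<and> kH M H r = c \<and> (\<forall>s\<in>{r<..<2 * M}. kH M H s > c))"

definition dom2 :: "real \<Rightarrow> real \<Rightarrow> real \<Rightarrow> real set" where
  "dom2 M H c =
     (if c < cH M H then {0<..<2 * M}
      else if c = cH M H then {rH M H<..<2 * M}
      else {r_turn M H c..<2 * M})"

text \<open>The second branch, with base point \<open>b'\<close> and constant \<open>k'\<close>, is only present for
  \<open>c > cH M H\<close>; \<open>branches_match\<close> says that the two branches then meet at \<open>r''\<close>.\<close>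

definition \<Sigma>2 :: "real \<Rightarrow> real \<Rightarrow> real \<Rightarrow> real \<Rightarrow> real \<Rightarrow> real \<Rightarrow> real \<Rightarrow> point set" where
  "\<Sigma>2 M H c b k b' k' =
     graph_in M region_II (dom2 M H c) (f2_star M H c b k) \<union>
     (if c > cH M H then graph_in M region_II (dom2 M H c) (f2_star2 M H c b' k') else {})"

definition branches_match ::
    "real \<Rightarrow> real \<Rightarrow> real \<Rightarrow> real \<Rightarrow> real \<Rightarrow> real \<Rightarrow> real \<Rightarrow> bool" where
  "branches_match M H c b k b' k' \<longleftrightarrow>
     (c > cH M H \<longrightarrow>
        f2_star M H c b k (r_turn M H c) = f2_star2 M H c b' k' (r_turn M H c))"

text \<open>The common expression for \<open>f1' + 1/h\<close> in region I and \<open>f2_star' + 1/h\<close> in region II.\<close>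

definition fbar' :: "real \<Rightarrow> real \<Rightarrow> real \<Rightarrow> real \<Rightarrow> real" where
  "fbar' M H c r =
     r ^ 4 / ((H * r ^ 3 + c)\<^sup>2 + r ^ 3 * (r - 2 * M)
       - (H * r ^ 3 + c) * sqrt ((H * r ^ 3 + c)\<^sup>2 + r ^ 3 * (r - 2 * M)))"

end

theory Submission
  imports Defs "HOL-Real_Asymp.Real_Asymp"
begin

text \<open>Let \<open>r\<^sup>*\<close> be the tortoise coordinate, an antiderivative of \<open>1/h\<close>. Then \<open>t + r\<^sup>* = 4M ln |V|\<close>
  and \<open>t - r\<^sup>* = - 4M ln |U|\<close>. On \<open>\<Sigma>1\<close> and on the first branch of \<open>\<Sigma>2\<close> the function \<open>t + r\<^sup>*\<close> is an
  integral of \<open>fbar'\<close>, and on \<open>\<Sigma>3\<close> and on the second branch of \<open>\<Sigma>2\<close> so is \<open>- (t - r\<^sup>*)\<close>; these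
  integrals are continuous across \<open>r = 2M\<close>. Hence each piece meets exactly one horizon, in
  one sphere whose position is given by the value of the integral at \<open>2M\<close>. The limiting sphere
  is approached from both sides: otherwise \<open>U\<close> (or \<open>V\<close>) restricted to the hypersurface would have a
  local extremum there, and its tangent space would contain the null direction of the horizon,
  contradicting spacelikeness. Equating the two positions gives the relations between the
  constants.\<close>

subsection \<open>Spacelike hypersurfaces cross the horizon\<close>

text \<open>The tangent space has dimension three, and so has the space orthogonal to
  \<open>a\<close> and to the normal of the unit sphere. A local maximum of
  \<open>a \<bullet> fst q\<close> puts the former inside the latter, so the two agree, and the
  latter contains the null direction of the horizon. As \<open>fst a * snd a = 0\<close>, the
  function is a multiple of \<open>U\<close> or of \<open>V\<close>.\<close>

lemma extremal_null_coordinate_not_spacelike: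
  fixes a :: "real \<times> real"
  assumes hyp: "smooth_hypersurface M S" and sp: "spacelike M S"
    and p: "p \<in> S" and a: "a \<noteq> 0" "fst a * snd a = 0" and W: "open W" "p \<in> W"
    and max: "\<And>q. q \<in> S \<inter> W \<Longrightarrow> a \<bullet> fst q \<le> a \<bullet> fst p"
  shows False
proof -
  obtain A \<phi> x where lp: "local_param S A \<phi>" and x: "x \<in> A" "p = \<phi> x"
    using hyp p unfolding smooth_hypersurface_def by blast
  have A: "open A" and inj: "inj (frechet_derivative \<phi> (at x))" and img: "\<phi> ` A \<subseteq> S"
    and diff: "\<phi> differentiable (at x)" and cont: "continuous_on A \<phi>"
  proof -
    show "open A" "inj (frechet_derivative \<phi> (at x))" "\<phi> ` A \<subseteq> S" "continuous_on A \<phi>"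
      using lp x unfolding local_param_def by (auto simp: homeomorphism_def)
    have "C_k_on (Suc 0) A \<phi>"
      using lp unfolding local_param_def smooth_on_def by blast
    then show "\<phi> differentiable (at x)" using x by simp
  qed
  define L where "L = frechet_derivative \<phi> (at x)"
  have L: "(\<phi> has_derivative L) (at x)"
    using diff unfolding L_def frechet_derivative_works .
  have linL: "linear L" using L has_derivative_linear by blast
  define B where "B = A \<inter> \<phi> -` W"
  have B: "open B" "x \<in> B"
    unfolding B_def using continuous_open_preimage[OF cont A W(1)] x W by auto
  have "(\<lambda>v. a \<bullet> fst (L v)) = (\<lambda>v. 0)"
  proof (rule differential_zero_maxmin[OF B(2,1)])
    show "((\<lambda>y. a \<bullet> fst (\<phi> y)) has_derivative (\<lambda>v. a \<bullet> fst (L v))) (at x)"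
      by (intro derivative_intros L)
    show "(\<forall>y\<in>B. a \<bullet> fst (\<phi> y) \<le> a \<bullet> fst (\<phi> x)) \<or> (\<forall>y\<in>B. a \<bullet> fst (\<phi> x) \<le> a \<bullet> fst (\<phi> y))"
      using max img x unfolding B_def by blast
  qed
  then have d1: "a \<bullet> fst (L v) = 0" for v by metis
  have sph: "snd (\<phi> y) \<bullet> snd (\<phi> y) = 1" if "y \<in> A" for y
  proof -
    have "\<phi> y \<in> kruskal M" using that img hyp unfolding smooth_hypersurface_def by blast
    then have "norm (snd (\<phi> y)) = 1" unfolding kruskal_def by auto
    then show ?thesis by (simp add: norm_eq_1)
  qed
  \<comment> \<open>The squared norm of the sphere component is constantly 1 on \<open>A\<close>, so
    \<open>x\<close> is trivially an extremum of it.\<close>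
  have "(\<lambda>v. snd (\<phi> x) \<bullet> snd (L v) + snd (L v) \<bullet> snd (\<phi> x)) = (\<lambda>v. 0)"
  proof (rule differential_zero_maxmin[OF x(1) A])
    show "((\<lambda>y. snd (\<phi> y) \<bullet> snd (\<phi> y)) has_derivative
        (\<lambda>v. snd (\<phi> x) \<bullet> snd (L v) + snd (L v) \<bullet> snd (\<phi> x))) (at x)"
      by (intro derivative_intros L)
  qed (use sph x in auto)
  then have d2: "snd p \<bullet> snd (L v) = 0" for v
    using x(2) by (metis (no_types, lifting) inner_commute mult_2 mult_eq_0_iff zero_neq_numeral)
  \<comment> \<open>The tangent space is contained in \<open>E\<close>, which is also three-dimensional, so it contains the
    null vector along the horizon.\<close>
  define E where "E = {e. a \<bullet> e = 0} \<times> {w. snd p \<bullet> w = 0}"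
  have nz: "snd p \<noteq> 0" using sph x by force
  have "dim E = dim {e. a \<bullet> e = 0} + dim {w. snd p \<bullet> w = 0}"
    unfolding E_def by (intro dim_Times subspace_hyperplane)
  also have "\<dots> = 3" using dim_hyperplane[OF a(1)] dim_hyperplane[OF nz] by simp
  finally have dimE: "dim E = 3" .
  have "dim (range L) = 3" using dim_image_eq[OF linL, of UNIV] inj by (simp add: L_def)
  moreover have "L v \<in> E" for v using d1[of v] d2[of v] by (simp add: E_def mem_Times_iff)
  then have "range L \<subseteq> E" by blast
  moreover have "subspace E" unfolding E_def by (intro subspace_Times subspace_hyperplane)
  moreover have "subspace (range L)" using linL linear_subspace_image subspace_UNIV by blast
  ultimately have range: "range L = E" using dimE by (metis order_refl subspace_dim_equal)
  \<comment> \<open>Orthogonal to \<open>a\<close>, and null for \<open>dU dV\<close> because one of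
    the two entries is zero.\<close>
  define \<xi> :: point where "\<xi> = ((snd a, - fst a), 0)"
  have "\<xi> \<in> range L" unfolding range E_def \<xi>_def by (simp add: inner_prod_def)
  moreover have "\<xi> \<noteq> 0" using a(1) by (cases a) (auto simp: \<xi>_def zero_prod_def)
  ultimately have "kruskal_metric M (\<phi> x) \<xi> \<xi> > 0"
    using sp lp x unfolding spacelike_def L_def by blast
  moreover have "kruskal_metric M (\<phi> x) \<xi> \<xi> = 0"
    using a(2) by (simp add: kruskal_metric_def \<xi>_def Let_def mult.commute)
  ultimately show False by simp
qed

text \<open>The linear function given by \<open>a\<close> vanishes on \<open>B\<close> and has
  opposite strict signs on \<open>S\<close> and \<open>S'\<close>. If the closure of one piece
  missed a point of the limiting sphere, this function would have a local extremum there.\<close>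

lemma connects_smoothly_closure:
  fixes a :: "real \<times> real"
  assumes "connects_smoothly M B S S'"
    and a: "a \<noteq> 0" "fst a * snd a = 0"
    and B: "\<And>P. P \<in> B \<Longrightarrow> a \<bullet> P = 0"
    and S: "\<And>q. q \<in> S \<Longrightarrow> a \<bullet> fst q > 0" and S': "\<And>q. q \<in> S' \<Longrightarrow> a \<bullet> fst q < 0"
  obtains P \<omega> where "P \<in> B" "(P, \<omega>) \<in> closure S" "(P, \<omega>) \<in> closure S'"
proof -
  define \<omega> :: "real ^ 3" where "\<omega> = axis 1 1"
  obtain P where P: "P \<in> B" and hyp: "smooth_hypersurface M (S \<union> S' \<union> {P} \<times> sphere 0 1)"
    and sp: "spacelike M (S \<union> S' \<union> {P} \<times> sphere 0 1)"
    using assms(1) unfolding connects_smoothly_def by blast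
  have p: "(P, \<omega>) \<in> S \<union> S' \<union> {P} \<times> sphere 0 1" by (simp add: \<omega>_def)
  have "(P, \<omega>) \<in> closure S"
  proof (rule ccontr)
    assume "(P, \<omega>) \<notin> closure S"
    then have W: "open (- closure S)" "(P, \<omega>) \<in> - closure S" by auto
    show False
    proof (rule extremal_null_coordinate_not_spacelike[OF hyp sp p a W])
      show "a \<bullet> fst q \<le> a \<bullet> fst (P, \<omega>)"
        if "q \<in> (S \<union> S' \<union> {P} \<times> sphere 0 1) \<inter> - closure S" for q
        using that B[OF P] S'[of q] closure_subset[of S] by force
    qed
  qed
  moreover have "(P, \<omega>) \<in> closure S'"
  proof (rule ccontr)
    assume "(P, \<omega>) \<notin> closure S'"
    then have W: "open (- closure S')" "(P, \<omega>) \<in> - closure S'" by auto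
    show False
    \<comment> \<open>Away from \<open>S'\<close> the point is a local minimum of the function;
      negating \<open>a\<close> makes it a maximum.\<close>
    proof (rule extremal_null_coordinate_not_spacelike[OF hyp sp p _ _ W, of "- a"])
      show "- a \<bullet> fst q \<le> - a \<bullet> fst (P, \<omega>)"
        if "q \<in> (S \<union> S' \<union> {P} \<times> sphere 0 1) \<inter> - closure S'" for q
        using that B[OF P] S[of q] closure_subset[of S'] by force
    qed (use a in auto)
  qed
  ultimately show thesis using that P by blast
qed

subsection \<open>Null coordinates and the limit at the horizon\<close>

lemma kruskal_radius_strict_mono:
  assumes M: "M > (0::real)" and r: "0 \<le> r" "r < s"
  shows "(r - 2 * M) * exp (r / (2 * M)) < (s - 2 * M) * exp (s / (2 * M))"
proof (rule DERIV_pos_imp_increasing_open[OF r(2)])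
  show "\<exists>y. ((\<lambda>r. (r - 2 * M) * exp (r / (2 * M))) has_real_derivative y) (at x) \<and> 0 < y"
    if "r < x" "x < s" for x
  proof (intro exI conjI)
    show "((\<lambda>r. (r - 2 * M) * exp (r / (2 * M))) has_real_derivative x / (2 * M) * exp (x / (2 * M))) (at x)"
      using M by (auto intro!: derivative_eq_intros simp: field_simps)
    show "0 < x / (2 * M) * exp (x / (2 * M))" using M r that by simp
  qed
  show "continuous_on {r..s} (\<lambda>r. (r - 2 * M) * exp (r / (2 * M)))"
    using M by (auto intro!: continuous_intros)
qed

text \<open>The description in \<open>r_of\<close> is proper: the intermediate value theorem gives a
  radius, strict monotonicity makes it unique.\<close>

lemma r_of_eq:
  assumes M: "M > 0" and UV: "U * V > - 2 * M"
  shows "r_of M (U, V) > 0"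
    and "(r_of M (U, V) - 2 * M) * exp (r_of M (U, V) / (2 * M)) = U * V"
proof -
  let ?\<psi> = "\<lambda>r. (r - 2 * M) * exp (r / (2 * M))"
  \<comment> \<open>At \<open>?b\<close> the first factor is \<open>\<bar>U * V\<bar>\<close> and
    the exponential is at least 1; at radius 0 the value is \<open>- 2 * M\<close>, which lies below
    \<open>U * V\<close>.\<close>
  let ?b = "2 * M + \<bar>U * V\<bar>"
  have "?\<psi> ?b \<ge> \<bar>U * V\<bar> * 1" using M by (intro mult_mono) auto
  then have "\<exists>r\<ge>0. r \<le> ?b \<and> ?\<psi> r = U * V"
    using M UV by (intro IVT') (auto intro!: continuous_intros)
  then obtain r where r: "r \<ge> 0" "?\<psi> r = U * V" by blast
  with UV have "r > 0" by (cases "r = 0") auto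
  have "\<exists>!r. r > 0 \<and> ?\<psi> r = U * V"
  proof (rule ex1I)
    show "r > 0 \<and> ?\<psi> r = U * V" using r \<open>r > 0\<close> by blast
    show "s = r" if "s > 0 \<and> ?\<psi> s = U * V" for s
      using that r \<open>r > 0\<close> kruskal_radius_strict_mono[OF M, of s r] kruskal_radius_strict_mono[OF M, of r s]
      by (cases s r rule: linorder_cases) auto
  qed
  from theI'[OF this] show "r_of M (U, V) > 0" "?\<psi> (r_of M (U, V)) = U * V"
    unfolding r_of_def by auto
qed

text \<open>The radius function is strictly increasing and vanishes at \<open>2 * M\<close>, so each
  bound on the radius follows from a bound on \<open>U * V\<close>.\<close>

lemma r_of_tendsto_horizon:
  assumes M: "M > 0" and UV: "\<And>n. fst (q n) * snd (q n) > - 2 * M"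
    and lim: "(\<lambda>n. fst (q n) * snd (q n)) \<longlonglongrightarrow> 0"
  shows "(\<lambda>n. r_of M (q n)) \<longlonglongrightarrow> 2 * M"
proof -
  let ?\<psi> = "\<lambda>r. (r - 2 * M) * exp (r / (2 * M))"
  have r: "r_of M (q n) > 0" "?\<psi> (r_of M (q n)) = fst (q n) * snd (q n)" for n
    using r_of_eq[OF M UV[of n]] by auto
  show ?thesis
  proof (rule order_tendstoI)
    fix b assume b: "b < 2 * M"
    show "eventually (\<lambda>n. b < r_of M (q n)) sequentially"
    proof (cases "b \<le> 0")
      case True
      then show ?thesis using r(1) by (auto intro!: always_eventually simp: order.strict_trans1)
    next
      case False
      then have "?\<psi> b < ?\<psi> (2 * M)" using b by (intro kruskal_radius_strict_mono[OF M]) auto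
      then have "eventually (\<lambda>n. ?\<psi> b < fst (q n) * snd (q n)) sequentially"
        using order_tendstoD(1)[OF lim] by simp
      then show ?thesis
      proof eventually_elim
        case (elim n)
        show ?case
        proof (rule ccontr)
          assume "\<not> b < r_of M (q n)"
          then show False using elim r[of n] kruskal_radius_strict_mono[OF M, of "r_of M (q n)" b]
            by (cases "r_of M (q n) = b") auto
        qed
      qed
    qed
  next
    fix b assume b: "2 * M < b"
    then have "?\<psi> (2 * M) < ?\<psi> b" using M by (intro kruskal_radius_strict_mono[OF M]) auto
    then have "eventually (\<lambda>n. fst (q n) * snd (q n) < ?\<psi> b) sequentially"
      using order_tendstoD(2)[OF lim] by simp
    then show "eventually (\<lambda>n. r_of M (q n) < b) sequentially"
    proof eventually_elim
      case (elim n)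
      show ?case
      proof (rule ccontr)
        assume "\<not> r_of M (q n) < b"
        then show False using elim r[of n] kruskal_radius_strict_mono[OF M, of b "r_of M (q n)"] b M
          by (cases "r_of M (q n) = b") auto
      qed
    qed
  qed
qed

text \<open>The absolute value lets one formula serve on both sides of \<open>2 * M\<close>. With
  this additive constant the base point \<open>r1\<close> of the theorem has tortoise coordinate
  0.\<close>

definition tortoise :: "real \<Rightarrow> real \<Rightarrow> real" where
  "tortoise M r = r + 2 * M * ln \<bar>r - 2 * M\<bar>"

text \<open>The logarithm of the equation defining \<open>r\<close> gives
  \<open>2 * M * (ln \<bar>U\<bar> + ln \<bar>V\<bar>)\<close> as the tortoise coordinate, while
  \<open>t\<close> is the same multiple of the difference.\<close>

lemma null_coordinates:
  assumes M: "M > 0" and UV: "U * V > - 2 * M" and nz: "U \<noteq> 0" "V \<noteq> 0"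
  shows "t_of M (U, V) + tortoise M (r_of M (U, V)) = 4 * M * ln \<bar>V\<bar>"
    and "t_of M (U, V) - tortoise M (r_of M (U, V)) = - 4 * M * ln \<bar>U\<bar>"
proof -
  let ?r = "r_of M (U, V)"
  note r = r_of_eq[OF M UV]
  have ne: "?r - 2 * M \<noteq> 0"
  proof
    assume "?r - 2 * M = 0"
    with r(2) nz show False by simp
  qed
  have "ln \<bar>U\<bar> + ln \<bar>V\<bar> = ln \<bar>(?r - 2 * M) * exp (?r / (2 * M))\<bar>"
    unfolding r(2) using nz by (simp add: abs_mult ln_mult)
  also have "\<dots> = ln \<bar>?r - 2 * M\<bar> + ?r / (2 * M)"
    using ne by (simp add: abs_mult ln_mult)
  finally have "2 * M * (ln \<bar>U\<bar> + ln \<bar>V\<bar>) = tortoise M ?r"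
    using M by (simp add: tortoise_def field_simps)
  moreover have "t_of M (U, V) = 2 * M * (ln \<bar>V\<bar> - ln \<bar>U\<bar>)"
    using nz by (simp add: t_of_def ln_div)
  ultimately show "t_of M (U, V) + tortoise M ?r = 4 * M * ln \<bar>V\<bar>"
    "t_of M (U, V) - tortoise M ?r = - 4 * M * ln \<bar>U\<bar>"
    by (simp_all add: algebra_simps)
qed

lemma closure_graph_in_sequence:
  assumes M: "M > 0" and P: "U0 * V0 = 0" and Q: "\<And>U V. (U, V) \<in> Q \<Longrightarrow> U \<noteq> 0 \<and> V \<noteq> 0"
    and cl: "((U0, V0), \<omega>) \<in> closure (graph_in M Q J f)"
  obtains U V r where "U \<longlonglongrightarrow> U0" "V \<longlonglongrightarrow> V0" "r \<longlonglongrightarrow> 2 * M"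
    "\<And>n. r n \<in> J"
    "\<And>n. f (r n) + tortoise M (r n) = 4 * M * ln \<bar>V n\<bar>"
    "\<And>n. f (r n) - tortoise M (r n) = - 4 * M * ln \<bar>U n\<bar>"
    "\<And>n. U n \<noteq> 0" "\<And>n. V n \<noteq> 0"
proof -
  obtain x where x: "\<And>n. x n \<in> graph_in M Q J f" and lim: "x \<longlonglongrightarrow> ((U0, V0), \<omega>)"
    using cl unfolding closure_sequential by blast
  define q where "q = (\<lambda>n. fst (x n))"
  have limq: "q \<longlonglongrightarrow> (U0, V0)" unfolding q_def using tendsto_fst[OF lim] by simp
  have limU: "(\<lambda>n. fst (q n)) \<longlonglongrightarrow> U0" and limV: "(\<lambda>n. snd (q n)) \<longlonglongrightarrow> V0"
    using tendsto_fst[OF limq] tendsto_snd[OF limq] by simp_all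
  have q: "fst (q n) * snd (q n) > - 2 * M" "q n \<in> Q" "r_of M (q n) \<in> J"
    "t_of M (q n) = f (r_of M (q n))" for n
    using x[of n] unfolding graph_in_def kruskal_def q_def by auto
  have nz: "fst (q n) \<noteq> 0" "snd (q n) \<noteq> 0" for n
    using Q[of "fst (q n)" "snd (q n)"] q(2)[of n] by auto
  have "(\<lambda>n. fst (q n) * snd (q n)) \<longlonglongrightarrow> 0"
    using tendsto_mult[OF limU limV] P by simp
  then have "(\<lambda>n. r_of M (q n)) \<longlonglongrightarrow> 2 * M" using r_of_tendsto_horizon[OF M] q by blast
  moreover have "f (r_of M (q n)) + tortoise M (r_of M (q n)) = 4 * M * ln \<bar>snd (q n)\<bar>"
    "f (r_of M (q n)) - tortoise M (r_of M (q n)) = - 4 * M * ln \<bar>fst (q n)\<bar>" for n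
    using null_coordinates[OF M q(1)[of n] nz] q(4)[of n] by simp_all
  ultimately show thesis using that limU limV q nz by blast
qed

text \<open>\<open>F\<close> extends \<open>f + tortoise M\<close> continuously to the horizon, so
  the limit of \<open>\<bar>V\<bar>\<close> can be read off. The exponential form does not
  presuppose \<open>V0 \<noteq> 0\<close> but yields it; this later excludes a branch from the
  horizon \<open>V = 0\<close>.\<close>

lemma closure_graph_in_ingoing:
  assumes M: "M > 0" and P: "U0 * V0 = 0" and Q: "\<And>U V. (U, V) \<in> Q \<Longrightarrow> U \<noteq> 0 \<and> V \<noteq> 0"
    and cl: "((U0, V0), \<omega>) \<in> closure (graph_in M Q J f)"
    and F: "isCont F (2 * M)" "\<And>r. r \<in> J \<Longrightarrow> f r + tortoise M r = F r"
  shows "\<bar>V0\<bar> = exp (F (2 * M) / (4 * M))"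
proof -
  obtain V r where s: "V \<longlonglongrightarrow> V0" "r \<longlonglongrightarrow> 2 * M" "\<And>n. r n \<in> J"
    "\<And>n. f (r n) + tortoise M (r n) = 4 * M * ln \<bar>V n\<bar>" "\<And>n. V n \<noteq> 0"
    using closure_graph_in_sequence[OF M P Q cl] by metis
  have "F (r n) / (4 * M) = ln \<bar>V n\<bar>" for n
    using s(4)[of n] F(2)[OF s(3)[of n]] M by simp
  then have "(\<lambda>n. exp (F (r n) / (4 * M))) = (\<lambda>n. \<bar>V n\<bar>)" using s(5) by simp
  moreover have "(\<lambda>n. exp (F (r n) / (4 * M))) \<longlonglongrightarrow> exp (F (2 * M) / (4 * M))"
    using M by (intro tendsto_intros isCont_tendsto_compose[OF F(1)] s) auto
  ultimately show ?thesis using tendsto_rabs[OF s(1)] LIMSEQ_unique by metis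
qed

text \<open>Mirror image for \<open>U\<close>: a graph with \<open>f - tortoise M\<close> continuous
  up to the horizon cannot reach \<open>U = 0\<close>.\<close>

lemma closure_graph_in_outgoing:
  assumes M: "M > 0" and P: "U0 * V0 = 0" and Q: "\<And>U V. (U, V) \<in> Q \<Longrightarrow> U \<noteq> 0 \<and> V \<noteq> 0"
    and cl: "((U0, V0), \<omega>) \<in> closure (graph_in M Q J f)"
    and F: "isCont F (2 * M)" "\<And>r. r \<in> J \<Longrightarrow> f r - tortoise M r = F r"
  shows "\<bar>U0\<bar> = exp (- F (2 * M) / (4 * M))"
proof -
  obtain U r where s: "U \<longlonglongrightarrow> U0" "r \<longlonglongrightarrow> 2 * M" "\<And>n. r n \<in> J"
    "\<And>n. f (r n) - tortoise M (r n) = - 4 * M * ln \<bar>U n\<bar>" "\<And>n. U n \<noteq> 0"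
    using closure_graph_in_sequence[OF M P Q cl] by metis
  have "- F (r n) / (4 * M) = ln \<bar>U n\<bar>" for n
    using s(4)[of n] F(2)[OF s(3)[of n]] M by simp
  then have "(\<lambda>n. exp (- F (r n) / (4 * M))) = (\<lambda>n. \<bar>U n\<bar>)" using s(5) by simp
  moreover have "(\<lambda>n. exp (- F (r n) / (4 * M))) \<longlonglongrightarrow> exp (- F (2 * M) / (4 * M))"
    using M by (intro tendsto_intros isCont_tendsto_compose[OF F(1)] s) auto
  ultimately show ?thesis using tendsto_rabs[OF s(1)] LIMSEQ_unique by metis
qed

subsection \<open>The function \<open>kH\<close> has a unique critical point\<close>

lemma kH_eq_sqrt:
  assumes "0 < r" "r < 2 * M"
  shows "kH M H r = - H * r ^ 3 - sqrt (r ^ 3 * (2 * M - r))"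
proof -
  have "r powr (3 / 2) = sqrt (r ^ 3)"
    using assms powr_half_sqrt_powr[of r 3] by (simp add: powr_numeral)
  then show ?thesis using assms by (simp add: kH_def powr_half_sqrt real_sqrt_mult)
qed

text \<open>The derivative of \<open>kH M H\<close> is
  \<open>r\<^sup>2 * (kH_slope M r - 3 * H)\<close>; dividing out \<open>r\<^sup>2\<close> separates
  \<open>H\<close>, so critical points solve \<open>kH_slope M r = 3 * H\<close>.\<close>

definition kH_slope :: "real \<Rightarrow> real \<Rightarrow> real" where
  "kH_slope M r = (2 * r - 3 * M) / sqrt (r ^ 3 * (2 * M - r))"

lemma kH_slope_less:
  assumes r: "0 < r" "r < s" "s < 2 * M"
  shows "kH_slope M r < kH_slope M s"
proof (rule DERIV_pos_imp_increasing[OF r(2)])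
  fix x assume x: "r \<le> x" "x \<le> s"
  define g where "g = sqrt (x ^ 3 * (2 * M - x))"
  have w: "x ^ 3 * (2 * M - x) > 0" using x r by simp
  then have g: "g > 0" "g ^ 2 = x ^ 3 * (2 * M - x)" by (simp_all add: g_def)
  have "((\<lambda>x. sqrt (x ^ 3 * (2 * M - x))) has_real_derivative
      (3 * x ^ 2 * (2 * M - x) - x ^ 3) / (2 * g)) (at x)"
    using w by (auto intro!: derivative_eq_intros simp: g_def divide_simps)
  moreover have "((\<lambda>x. 2 * x - 3 * M) has_real_derivative 2) (at x)"
    by (auto intro!: derivative_eq_intros)
  ultimately have "((\<lambda>x. (2 * x - 3 * M) / sqrt (x ^ 3 * (2 * M - x))) has_real_derivative
      (2 * g - (2 * x - 3 * M) * ((3 * x ^ 2 * (2 * M - x) - x ^ 3) / (2 * g))) / (g * g)) (at x)"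
    unfolding g_def using w by (intro DERIV_divide) auto
  then have "(kH_slope M has_real_derivative
      (2 * g - (2 * x - 3 * M) * ((3 * x ^ 2 * (2 * M - x) - x ^ 3) / (2 * g))) / g ^ 2) (at x)"
    unfolding kH_slope_def power2_eq_square[of g] .
  \<comment> \<open>Since \<open>3 * x ^ 2 * (2 * M - x) - x ^ 3 = - 2 * x ^ 2 * (2 * x - 3 *
    M)\<close>, the quotient rule produces a square with positive sign.\<close>
  moreover have "2 * g - (2 * x - 3 * M) * ((3 * x ^ 2 * (2 * M - x) - x ^ 3) / (2 * g))
     = 2 * g + (2 * x - 3 * M)\<^sup>2 * x ^ 2 / g"
    using g(1) by (simp add: field_simps power2_eq_square power3_eq_cube)
  moreover have "(2 * g + (2 * x - 3 * M)\<^sup>2 * x ^ 2 / g) / g ^ 2 > 0"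
    using g(1) by (intro divide_pos_pos add_pos_nonneg) auto
  ultimately show "\<exists>y. (kH_slope M has_real_derivative y) (at x) \<and> 0 < y" by metis
qed

lemma kH_has_derivative:
  assumes r: "0 < r" "r < 2 * M"
  shows "(kH M H has_real_derivative r\<^sup>2 * (kH_slope M r - 3 * H)) (at r)"
proof -
  define g where "g = sqrt (r ^ 3 * (2 * M - r))"
  have w: "r ^ 3 * (2 * M - r) > 0" using r by simp
  then have g: "g > 0" by (simp add: g_def)
  have "((\<lambda>r. sqrt (r ^ 3 * (2 * M - r))) has_real_derivative
      (3 * r ^ 2 * (2 * M - r) - r ^ 3) / (2 * g)) (at r)"
    using w by (auto intro!: derivative_eq_intros simp: g_def divide_simps)
  moreover have "((\<lambda>r. - H * r ^ 3) has_real_derivative - H * (3 * r\<^sup>2)) (at r)"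
    by (auto intro!: derivative_eq_intros)
  ultimately have "((\<lambda>r. - H * r ^ 3 - sqrt (r ^ 3 * (2 * M - r))) has_real_derivative
      - H * (3 * r\<^sup>2) - (3 * r ^ 2 * (2 * M - r) - r ^ 3) / (2 * g)) (at r)"
    by (intro DERIV_diff)
  moreover have "- H * (3 * r\<^sup>2) - (3 * r ^ 2 * (2 * M - r) - r ^ 3) / (2 * g)
      = r\<^sup>2 * (kH_slope M r - 3 * H)"
    unfolding kH_slope_def g_def[symmetric] using g
    by (simp add: field_simps power2_eq_square power3_eq_cube)
  ultimately have "((\<lambda>r. - H * r ^ 3 - sqrt (r ^ 3 * (2 * M - r))) has_real_derivative
      r\<^sup>2 * (kH_slope M r - 3 * H)) (at r)" by metis
  then show ?thesis
    by (rule has_field_derivative_transform_within_open[of _ _ _ "{0<..<2 * M}"])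
      (use r in \<open>auto simp: kH_eq_sqrt\<close>)
qed

text \<open>The numerator of the slope is negative near 0 and positive near \<open>2 * M\<close>,
  while the denominator tends to 0 at both ends, so the slope runs from minus to plus infinity.
  Choosing the two points on either side of \<open>M\<close> puts them in order.\<close>

lemma kH_critical_point:
  assumes M: "M > 0"
  obtains r where "0 < r" "r < 2 * M" "kH_slope M r = 3 * H"
proof -
  have "filterlim (kH_slope M) at_bot (at_right 0)"
    unfolding kH_slope_def using M by real_asymp
  moreover have "eventually (\<lambda>r. r \<in> {0<..<M}) (at_right 0)"
    using M by (intro eventually_at_right_real)
  ultimately have "eventually (\<lambda>r. kH_slope M r \<le> 3 * H \<and> r \<in> {0<..<M}) (at_right 0)"
    by (auto simp: filterlim_at_bot intro: eventually_conj)
  then obtain a where a: "0 < a" "a < M" "kH_slope M a \<le> 3 * H"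
    using eventually_happens'[OF trivial_limit_at_right_real] by force
  have "filterlim (kH_slope M) at_top (at_left (2 * M))"
    unfolding kH_slope_def using M by real_asymp
  moreover have "eventually (\<lambda>r. r \<in> {M<..<2 * M}) (at_left (2 * M))"
    using M by (intro eventually_at_left_real) auto
  ultimately have "eventually (\<lambda>r. kH_slope M r \<ge> 3 * H \<and> r \<in> {M<..<2 * M}) (at_left (2 * M))"
    by (auto simp: filterlim_at_top intro: eventually_conj)
  then obtain b where b: "M < b" "b < 2 * M" "kH_slope M b \<ge> 3 * H"
    using eventually_happens'[OF trivial_limit_at_left_real] by force
  have "\<exists>r\<ge>a. r \<le> b \<and> kH_slope M r = 3 * H"
    unfolding kH_slope_def
    by (rule IVT'; (use a b in \<open>auto simp: kH_slope_def intro!: continuous_intros\<close>))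
  then obtain r where "a \<le> r" "r \<le> b" "kH_slope M r = 3 * H" by blast
  then show thesis using that[of r] a b by simp
qed

text \<open>As the slope increases strictly, \<open>kH M H\<close> decreases before its only
  critical point and increases after it. That point is therefore the unique minimum described by
  \<open>rH\<close>.\<close>

lemma rH_properties:
  assumes M: "M > 0"
  shows "0 < rH M H" "rH M H < 2 * M"
    and "\<And>r. rH M H < r \<Longrightarrow> r < 2 * M \<Longrightarrow> kH_slope M r > 3 * H"
    and "\<And>r. 0 < r \<Longrightarrow> r < 2 * M \<Longrightarrow> r \<noteq> rH M H \<Longrightarrow> kH M H r > cH M H"
    and "\<And>r s. rH M H \<le> r \<Longrightarrow> r < s \<Longrightarrow> s < 2 * M \<Longrightarrow> kH M H r < kH M H s"
proof -
  obtain q where q: "0 < q" "q < 2 * M" "kH_slope M q = 3 * H"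
    using kH_critical_point[OF M] .
  have cont: "continuous_on {r..s} (kH M H)" if "0 < r" "s < 2 * M" for r s
    by (intro DERIV_continuous_on[OF has_field_derivative_at_within[OF kH_has_derivative]])
      (use that in auto)
  have inc: "kH M H r < kH M H s" if "q \<le> r" "r < s" "s < 2 * M" for r s
  proof (rule DERIV_pos_imp_increasing_open[OF that(2)])
    show "\<exists>y. (kH M H has_real_derivative y) (at x) \<and> 0 < y" if "r < x" "x < s" for x
    proof (intro exI conjI)
      show "(kH M H has_real_derivative x\<^sup>2 * (kH_slope M x - 3 * H)) (at x)"
        using that q \<open>q \<le> r\<close> \<open>s < 2 * M\<close> by (intro kH_has_derivative) auto
      show "0 < x\<^sup>2 * (kH_slope M x - 3 * H)"
        using that q \<open>q \<le> r\<close> \<open>s < 2 * M\<close> kH_slope_less[of q x M] by auto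
    qed
  qed (use that q in \<open>auto intro!: cont\<close>)
  have dec: "kH M H r > kH M H q" if "0 < r" "r < q" for r
  proof (rule DERIV_neg_imp_decreasing_open[OF that(2)])
    show "\<exists>y. (kH M H has_real_derivative y) (at x) \<and> y < 0" if "r < x" "x < q" for x
    proof (intro exI conjI)
      show "(kH M H has_real_derivative x\<^sup>2 * (kH_slope M x - 3 * H)) (at x)"
        using that q \<open>0 < r\<close> by (intro kH_has_derivative) auto
      show "x\<^sup>2 * (kH_slope M x - 3 * H) < 0"
        using that q \<open>0 < r\<close> kH_slope_less[of x q M] by (auto simp: mult_less_0_iff)
    qed
  qed (use that q in \<open>auto intro!: cont\<close>)
  have min: "kH M H r > kH M H q" if "0 < r" "r < 2 * M" "r \<noteq> q" for r
    using that inc[of q r] dec[of r] by linarith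
  have rH: "rH M H = q" unfolding rH_def
  proof (rule the_equality)
    show "q \<in> {0<..<2 * M} \<and> (\<forall>s\<in>{0<..<2 * M}. kH M H q \<le> kH M H s)"
      using q min by (metis greaterThanLessThan_iff less_eq_real_def)
    show "r = q" if "r \<in> {0<..<2 * M} \<and> (\<forall>s\<in>{0<..<2 * M}. kH M H r \<le> kH M H s)" for r
    proof (rule ccontr)
      assume "r \<noteq> q"
      then have "kH M H q < kH M H r" using that by (intro min) auto
      moreover have "kH M H r \<le> kH M H q" using that q by auto
      ultimately show False by linarith
    qed
  qed
  show "0 < rH M H" "rH M H < 2 * M" using q rH by auto
  show "kH_slope M r > 3 * H" if "rH M H < r" "r < 2 * M" for r
    using kH_slope_less[of q r M] that q rH by auto
  show "kH M H r > cH M H" if "0 < r" "r < 2 * M" "r \<noteq> rH M H" for r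
    using min that unfolding cH_def rH by auto
  show "kH M H r < kH M H s" if "rH M H \<le> r" "r < s" "s < 2 * M" for r s
    using inc that rH by auto
qed

lemma r_turn_properties:
  assumes M: "M > 0" and c: "cH M H < c" "c < - 8 * M ^ 3 * H"
  shows "rH M H < r_turn M H c" "r_turn M H c < 2 * M"
    and "kH M H (r_turn M H c) = c"
    and "\<And>r. r_turn M H c < r \<Longrightarrow> r < 2 * M \<Longrightarrow> c < kH M H r"
proof -
  note rH = rH_properties[OF M, of H]
  \<comment> \<open>The square root form is continuous up to \<open>2 * M\<close>, where its value
    is \<open>- 8 * M ^ 3 * H\<close>. The intermediate value theorem runs from
    \<open>cH M H\<close> at \<open>rH M H\<close> to this value.\<close>
  let ?k = "\<lambda>r. - H * r ^ 3 - sqrt (r ^ 3 * (2 * M - r))"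
  have "\<exists>q\<ge>rH M H. q \<le> 2 * M \<and> ?k q = c"
  proof (rule IVT')
    show "?k (rH M H) \<le> c" using c rH(1,2) kH_eq_sqrt[of "rH M H" M H] unfolding cH_def by simp
    show "c \<le> ?k (2 * M)" using c(2) by (simp add: power_mult_distrib mult.commute)
    show "rH M H \<le> 2 * M" using rH by simp
    show "continuous_on {rH M H..2 * M} ?k" by (intro continuous_intros)
  qed
  then obtain q where q: "rH M H \<le> q" "q \<le> 2 * M" "?k q = c" by blast
  have "q \<noteq> 2 * M" using c(2) q(3) by (auto simp: power_mult_distrib mult.commute)
  then have q2: "q < 2 * M" using q by simp
  then have kq: "kH M H q = c" using kH_eq_sqrt[of q M H] q rH(1) by simp
  then have q1: "rH M H < q" using q(1) c(1) unfolding cH_def by (cases "q = rH M H") auto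
  have gt: "kH M H r > c" if "q < r" "r < 2 * M" for r
    using rH(5)[of q r] that q kq by simp
  have "r_turn M H c = q" unfolding r_turn_def
  proof (rule the_equality)
    show "q \<in> {0<..<2 * M} \<and> kH M H q = c \<and> (\<forall>s\<in>{q<..<2 * M}. kH M H s > c)"
      using q1 q2 kq gt rH(1) by auto
    show "r = q" if r: "r \<in> {0<..<2 * M} \<and> kH M H r = c \<and> (\<forall>s\<in>{r<..<2 * M}. kH M H s > c)" for r
    proof (cases r q rule: linorder_cases)
      case less
      then have "kH M H q > c" using r q2 by auto
      then show ?thesis using kq by simp
    next
      case greater
      then have "kH M H r > c" using r gt by auto
      then show ?thesis using r by simp
    qed
  qed
  then show "rH M H < r_turn M H c" "r_turn M H c < 2 * M" "kH M H (r_turn M H c) = c"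
    "\<And>r. r_turn M H c < r \<Longrightarrow> r < 2 * M \<Longrightarrow> c < kH M H r"
    using q1 q2 kq gt by auto
qed

subsection \<open>Integrands of the height functions\<close>

text \<open>The common numerator of \<open>l1\<close> and \<open>l2\<close>: outside,
  \<open>l1\<close> is \<open>flux\<close> over \<open>sqrt (h M r) * r\<^sup>2\<close>; inside,
  \<open>l2\<close> is \<open>- flux\<close> over \<open>sqrt (- h M r) * r\<^sup>2\<close>.\<close>

definition flux :: "real \<Rightarrow> real \<Rightarrow> real \<Rightarrow> real" where
  "flux H c r = H * r ^ 3 + c"

text \<open>Equals the square of \<open>flux\<close> plus \<open>h M r * r ^ 4\<close>. Up to the
  factor \<open>\<bar>h M r\<bar> * r ^ 4\<close> it is \<open>1 + l1\<^sup>2\<close> outside and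
  \<open>l2\<^sup>2 - 1\<close> inside.\<close>

definition disc :: "real \<Rightarrow> real \<Rightarrow> real \<Rightarrow> real \<Rightarrow> real" where
  "disc M H c r = (flux H c r)\<^sup>2 + r ^ 3 * (r - 2 * M)"

text \<open>Here the denominator \<open>sqrt disc * (sqrt disc - flux)\<close> of
  \<open>fbar'\<close> is positive. Beyond \<open>2 * M\<close> this holds for either sign of
  \<open>flux\<close>, because \<open>disc\<close> exceeds its square there; up to
  \<open>2 * M\<close> it takes \<open>flux < 0\<close>.\<close>

definition regular_radii :: "real \<Rightarrow> real \<Rightarrow> real \<Rightarrow> real set" where
  "regular_radii M H c = {r. 0 < r \<and> 0 < disc M H c r \<and> (flux H c r < 0 \<or> 2 * M < r)}"

lemma fbar'_eq_disc:
  "fbar' M H c r = r ^ 4 / (disc M H c r - flux H c r * sqrt (disc M H c r))"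
  by (simp add: fbar'_def disc_def flux_def)

lemma flux_less_sqrt_disc:
  assumes "r \<in> regular_radii M H c"
  shows "flux H c r < sqrt (disc M H c r)"
proof (cases "flux H c r < 0")
  case True
  then show ?thesis using assms by (simp add: regular_radii_def order.strict_trans)
next
  case False
  then have "(flux H c r)\<^sup>2 < disc M H c r"
    using assms by (simp add: regular_radii_def disc_def)
  then show ?thesis by (rule real_less_rsqrt)
qed

lemma fbar'_denominator_pos:
  assumes "r \<in> regular_radii M H c"
  shows "disc M H c r - flux H c r * sqrt (disc M H c r) > 0"
proof -
  have "sqrt (disc M H c r) * (sqrt (disc M H c r) - flux H c r) > 0"
    using assms flux_less_sqrt_disc[OF assms] by (simp add: regular_radii_def)
  then show ?thesis using assms by (simp add: regular_radii_def algebra_simps)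
qed

lemma isCont_fbar':
  assumes "r \<in> regular_radii M H c"
  shows "isCont (fbar' M H c) r"
  using fbar'_denominator_pos[OF assms] unfolding fbar'_def disc_def flux_def
  by (intro continuous_intros) auto

lemma h_neq_0: "0 < r \<Longrightarrow> r \<noteq> 2 * M \<Longrightarrow> h M r \<noteq> 0"
  by (simp add: h_def)

lemma disc_eq_h: "0 < r \<Longrightarrow> disc M H c r = (flux H c r)\<^sup>2 + h M r * r ^ 4"
  by (simp add: disc_def h_def field_simps power_numeral_reduce)

text \<open>Writing \<open>r ^ 4\<close> as \<open>(disc - flux\<^sup>2) / h\<close> and cancelling
  \<open>sqrt disc - flux\<close> gives \<open>(sqrt disc + flux) / (h * sqrt disc)\<close>. The
  form in \<open>fbar'\<close> has no factor \<open>h\<close> below, and so stays continuous at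
  \<open>2 * M\<close>.\<close>

lemma fbar'_minus_inverse_h:
  assumes r: "r \<in> regular_radii M H c" "r \<noteq> 2 * M"
  shows "fbar' M H c r - 1 / h M r = flux H c r / (h M r * sqrt (disc M H c r))"
proof -
  define s where "s = sqrt (disc M H c r)"
  have pos: "0 < r" "0 < s" "0 < s - flux H c r" and h: "h M r \<noteq> 0"
    using r flux_less_sqrt_disc[OF r(1)] h_neq_0[of r M] unfolding regular_radii_def s_def by auto
  have s2: "s\<^sup>2 = disc M H c r" using r unfolding s_def regular_radii_def by simp
  then have r4: "r ^ 4 = (s\<^sup>2 - (flux H c r)\<^sup>2) / h M r" using disc_eq_h[OF pos(1)] h by simp
  have "fbar' M H c r = (s\<^sup>2 - (flux H c r)\<^sup>2) / h M r / (s * (s - flux H c r))"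
    unfolding fbar'_eq_disc r4[symmetric] s2[symmetric] using pos
    by (simp add: s_def[symmetric] power2_eq_square algebra_simps)
  also have "\<dots> = (s + flux H c r) / (h M r * s)"
    using pos h by (simp add: divide_simps) (simp add: power2_eq_square algebra_simps)
  also have "\<dots> = 1 / h M r + flux H c r / (h M r * s)"
    using pos h by (simp add: field_simps)
  finally show ?thesis by (simp add: s_def)
qed

lemma f1_integrand:
  assumes M: "M > 0" and r: "r \<in> regular_radii M H c" "2 * M < r"
  shows "l1 M H c r / h M r * (1 / sqrt (1 + (l1 M H c r)\<^sup>2)) = fbar' M H c r - 1 / h M r"
proof -
  have r0: "0 < r" using M r by simp
  have h: "h M r > 0" using M r by (simp add: h_def field_simps)
  have l: "l1 M H c r = flux H c r / (sqrt (h M r) * r\<^sup>2)"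
    using r0 h by (simp add: l1_def flux_def field_simps power_numeral_reduce)
  have sqrt_r4: "sqrt (r ^ 4) = r\<^sup>2"
    using r0 by (intro real_sqrt_unique) (simp_all flip: power_mult)
  have "1 + (l1 M H c r)\<^sup>2 = disc M H c r / (h M r * r ^ 4)"
    unfolding l disc_eq_h[OF r0] using r0 h
    by (simp add: power_divide power_mult_distrib field_simps)
  then have "sqrt (1 + (l1 M H c r)\<^sup>2) = sqrt (disc M H c r) / (sqrt (h M r) * r\<^sup>2)"
    using r0 by (simp add: real_sqrt_divide real_sqrt_mult sqrt_r4)
  then show ?thesis unfolding fbar'_minus_inverse_h[OF r(1) r(2)[THEN less_imp_neq, symmetric]] l
    using h r0 by simp
qed

lemma f2_star_integrand:
  assumes r: "r \<in> regular_radii M H c" "r < 2 * M"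
  shows "1 / (- h M r) * sqrt ((l2 M H c r)\<^sup>2 / ((l2 M H c r)\<^sup>2 - 1)) = fbar' M H c r - 1 / h M r"
proof -
  have r0: "0 < r" and f: "flux H c r < 0" and d: "disc M H c r > 0"
    using r by (auto simp: regular_radii_def)
  have h: "h M r < 0" using r0 r by (simp add: h_def field_simps)
  have l: "l2 M H c r = - flux H c r / (sqrt (- h M r) * r\<^sup>2)"
    using r0 h by (simp add: l2_def flux_def field_simps power_numeral_reduce)
  have l2: "(l2 M H c r)\<^sup>2 = (flux H c r)\<^sup>2 / (- h M r * r ^ 4)"
    unfolding l using h by (simp add: power_divide power_mult_distrib)
  have "(l2 M H c r)\<^sup>2 - 1 = disc M H c r / (- h M r * r ^ 4)"
    unfolding l2 disc_eq_h[OF r0] using r0 h by (simp add: field_simps)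
  then have "(l2 M H c r)\<^sup>2 / ((l2 M H c r)\<^sup>2 - 1) = (flux H c r)\<^sup>2 / disc M H c r"
    unfolding l2 using h r0 by simp
  \<comment> \<open>The root of the squared flux is \<open>- flux\<close>, as \<open>flux\<close> is
    negative inside; this sign makes the integrand agree with the exterior formula.\<close>
  then have "sqrt ((l2 M H c r)\<^sup>2 / ((l2 M H c r)\<^sup>2 - 1)) = - flux H c r / sqrt (disc M H c r)"
    using f by (simp add: real_sqrt_divide)
  then show ?thesis unfolding fbar'_minus_inverse_h[OF r(1) less_imp_neq[OF r(2)]]
    using h by simp
qed

subsection \<open>Height functions in null coordinates\<close>

text \<open>The bound on \<open>c\<close> says that \<open>flux H c (2 * M)\<close> is negative,
  which makes the horizon radius regular.\<close>

locale cmc_family =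
  fixes M H c :: real
  assumes M_pos: "M > 0" and c_less: "c < - 8 * M ^ 3 * H"
begin

section \<open>Regular radii and the domain of the interior piece\<close>

lemma regular_exterior:
  assumes "2 * M \<le> r"
  shows "r \<in> regular_radii M H c"
proof (cases "r = 2 * M")
  case True
  have "flux H c (2 * M) < 0"
    using c_less by (simp add: flux_def power_mult_distrib algebra_simps)
  then show ?thesis using M_pos unfolding True regular_radii_def disc_def by simp
next
  case False
  then have "r > 2 * M" using assms by simp
  then have "r > 0" "r ^ 3 * (r - 2 * M) > 0" using M_pos by auto
  then show ?thesis using \<open>r > 2 * M\<close> unfolding regular_radii_def disc_def
    by (auto intro: add_nonneg_pos)
qed

text \<open>\<open>c < kH M H r\<close> says that \<open>- flux\<close> exceeds
  \<open>sqrt (r ^ 3 * (2 * M - r))\<close>; squaring makes \<open>disc\<close> positive.\<close>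

lemma regular_interior:
  assumes r: "0 < r" "r < 2 * M" "c < kH M H r"
  shows "r \<in> regular_radii M H c"
proof -
  have lt: "sqrt (r ^ 3 * (2 * M - r)) < - flux H c r"
    using r kH_eq_sqrt[of r M H] by (simp add: flux_def)
  moreover have "0 < sqrt (r ^ 3 * (2 * M - r))" using r by simp
  moreover from lt have "r ^ 3 * (2 * M - r) < (flux H c r)\<^sup>2"
    using power_strict_mono[OF lt, of 2] r by simp
  moreover have "r ^ 3 * (r - 2 * M) = - (r ^ 3 * (2 * M - r))" by (simp add: algebra_simps)
  ultimately have "0 < disc M H c r" "flux H c r < 0"
    unfolding disc_def by (linarith, linarith)
  then show ?thesis using r unfolding regular_radii_def by simp
qed

text \<open>The infimum of \<open>dom2 M H c\<close> in all three cases; it belongs to the domain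
  only in the third.\<close>

definition left_end :: real where
  "left_end = (if c < cH M H then 0 else if c = cH M H then rH M H else r_turn M H c)"

abbreviation radii :: "real set" where
  "radii \<equiv> dom2 M H c \<union> {2 * M..}"

lemma left_end: "0 \<le> left_end" "left_end < 2 * M"
proof -
  have "0 < r_turn M H c \<and> r_turn M H c < 2 * M" if "cH M H < c"
    using r_turn_properties(1,2)[OF M_pos that c_less] rH_properties(1)[OF M_pos, of H] by simp
  then show "0 \<le> left_end" "left_end < 2 * M"
    using rH_properties(1,2)[OF M_pos, of H] M_pos unfolding left_end_def by auto
qed

lemma dom2_bounds:
  shows "r \<in> dom2 M H c \<Longrightarrow> left_end \<le> r" "r \<in> dom2 M H c \<Longrightarrow> r < 2 * M"
    and "left_end < r \<Longrightarrow> r < 2 * M \<Longrightarrow> r \<in> dom2 M H c"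
    and "left_end \<in> dom2 M H c \<longleftrightarrow> cH M H < c"
  using left_end unfolding dom2_def left_end_def by (auto split: if_splits)

lemma radiiI: "left_end < r \<Longrightarrow> r \<in> radii"
  using dom2_bounds(3) by force

lemma left_end_le_radii: "r \<in> radii \<Longrightarrow> left_end \<le> r"
  using dom2_bounds(1) left_end by force

lemma regular_above_left_end:
  assumes "left_end < r"
  shows "r \<in> regular_radii M H c"
proof (cases "r < 2 * M")
  case True
  have "0 < r" using assms left_end by simp
  moreover have "c < kH M H r"
  proof -
    consider "c < cH M H" | "c = cH M H" | "cH M H < c" by linarith
    then show ?thesis
    proof cases
      case 1
      then show ?thesis using rH_properties(4)[OF M_pos, of r H] True \<open>0 < r\<close>
        by (cases "r = rH M H") (auto simp: cH_def)
    next
      case 2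
      then have "left_end = rH M H" unfolding left_end_def by simp
      then have "rH M H < r" using assms by simp
      then show ?thesis using rH_properties(4)[OF M_pos, of r H] True \<open>0 < r\<close> 2 by simp
    next
      case 3
      then show ?thesis using r_turn_properties(4)[OF M_pos 3 c_less, of r] True assms
        by (simp add: left_end_def)
    qed
  qed
  ultimately show ?thesis using True by (intro regular_interior)
qed (use regular_exterior in auto)

text \<open>The root of \<open>disc\<close> at the turning point is simple, so \<open>fbar'\<close> has there only an integrable
  singularity of order \<open>-1/2\<close>.\<close>

lemma disc_r_turn:
  assumes "cH M H < c"
  shows "disc M H c (r_turn M H c) = 0" "flux H c (r_turn M H c) < 0"
    and "\<exists>d>0. (disc M H c has_real_derivative d) (at (r_turn M H c))"
proof -
  define q where "q = r_turn M H c"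
  note t = r_turn_properties[OF M_pos assms c_less, folded q_def]
  note rH = rH_properties[OF M_pos, of H]
  have q: "0 < q" "q < 2 * M" "kH_slope M q > 3 * H" using t rH(1) rH(3)[of q] by auto
  define g where "g = sqrt (q ^ 3 * (2 * M - q))"
  have w: "q ^ 3 * (2 * M - q) > 0" using q by simp
  then have g: "g > 0" "g\<^sup>2 = q ^ 3 * (2 * M - q)" by (auto simp: g_def)
  have f: "flux H c q = - g"
    using t(3) kH_eq_sqrt[OF q(1,2), of H] by (simp add: flux_def g_def)
  show "disc M H c (r_turn M H c) = 0" "flux H c (r_turn M H c) < 0"
    unfolding q_def[symmetric] disc_def f using g by (simp_all add: algebra_simps)
  let ?d = "2 * flux H c q * (3 * H * q\<^sup>2) + (3 * q\<^sup>2 * (q - 2 * M) + q ^ 3)"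
  have "(disc M H c has_real_derivative ?d) (at q)"
    unfolding disc_def[abs_def] flux_def[abs_def]
    by (auto intro!: derivative_eq_intros simp: algebra_simps)
  \<comment> \<open>With \<open>flux = - g\<close> at the turning point, the derivative of
    \<open>disc\<close> is \<open>2 * g\<close> times that of \<open>kH M H\<close>, which is
    positive to the right of \<open>rH M H\<close>.\<close>
  moreover have "?d = 2 * q\<^sup>2 * g * (kH_slope M q - 3 * H)"
    unfolding f kH_slope_def g_def[symmetric] using g(1)
    by (simp add: field_simps power_numeral_reduce)
  moreover have "2 * q\<^sup>2 * g * (kH_slope M q - 3 * H) > 0" using q g by simp
  ultimately show "\<exists>d>0. (disc M H c has_real_derivative d) (at (r_turn M H c))"
    unfolding q_def[symmetric] by metis
qed

section \<open>Integrability and primitives of \<open>fbar'\<close>\<close>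

lemma fbar'_integrable_near_r_turn:
  assumes "cH M H < c"
  obtains b where "r_turn M H c < b" "set_integrable lborel {r_turn M H c<..<b} (fbar' M H c)"
proof -
  define q where "q = r_turn M H c"
  have le: "left_end = q" using assms by (simp add: left_end_def q_def)
  have q0: "0 < q" "q < 2 * M"
    using r_turn_properties(1,2)[OF M_pos assms c_less] rH_properties(1)[OF M_pos, of H] by (auto simp: q_def)
  note D = disc_r_turn[OF assms, folded q_def]
  obtain d where d: "d > 0" "(disc M H c has_real_derivative d) (at q)" using D(3) by blast
  \<comment> \<open>Half the size of the flux at \<open>q\<close>, so that \<open>flux < - F\<close>
    persists near \<open>q\<close>; likewise \<open>d / 2\<close> bounds the difference quotient of
    \<open>disc\<close> from below.\<close>
  define F where "F = - flux H c q / 2"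
  have F: "F > 0" using D(2) by (simp add: F_def)
  have "((\<lambda>r. (disc M H c r - disc M H c q) / (r - q)) \<longlongrightarrow> d) (at_right q)"
    using d(2) unfolding has_field_derivative_iff by (rule tendsto_within_subset) auto
  then have ev1: "eventually (\<lambda>r. d / 2 < disc M H c r / (r - q)) (at_right q)"
    using order_tendstoD(1)[of "\<lambda>r. disc M H c r / (r - q)" d "at_right q" "d / 2"] d(1) D(1)
    by simp
  have "((\<lambda>r. flux H c r) \<longlongrightarrow> flux H c q) (at_right q)"
    unfolding flux_def by (intro tendsto_intros)
  then have ev2: "eventually (\<lambda>r. flux H c r < - F) (at_right q)"
    by (rule order_tendstoD(2)) (use D(2) in \<open>simp add: F_def\<close>)
  have ev3: "eventually (\<lambda>r. r < 2 * M) (at_right q)"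
    using eventually_at_right_real[OF q0(2)] by (rule eventually_mono) auto
  obtain b where b: "q < b" and
    near: "\<And>r. q < r \<Longrightarrow> r < b \<Longrightarrow> d / 2 < disc M H c r / (r - q) \<and> flux H c r < - F \<and> r < 2 * M"
    using eventually_conj[OF ev1 eventually_conj[OF ev2 ev3]]
    unfolding eventually_at_right_field by auto
  \<comment> \<open>Combines the bound on the numerator \<open>x ^ 4\<close> with the lower bounds
    on the two factors of \<open>- flux * sqrt disc\<close>. The dominating function has the
    primitive \<open>2 * C * sqrt (x - q)\<close>.\<close>
  define C where "C = (2 * M) ^ 4 / (F * sqrt (d / 2))"
  have "set_integrable lborel (einterval q b) (\<lambda>x. C * (1 / sqrt (x - q)))"
  proof (intro set_integrable_mult_right impI)
    show "set_integrable lborel (einterval q b) (\<lambda>x. 1 / sqrt (x - q))"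
    proof (rule interval_integral_FTC_nonneg(1))
      show "((\<lambda>x. 2 * sqrt (x - q)) has_real_derivative 1 / sqrt (x - q)) (at x)"
        if "ereal q < ereal x" for x
        using that by (auto intro!: derivative_eq_intros simp: field_simps)
      show "isCont (\<lambda>x. 1 / sqrt (x - q)) x" if "ereal q < ereal x" for x
        using that by (auto intro!: continuous_intros)
      show "(((\<lambda>x. 2 * sqrt (x - q)) \<circ> real_of_ereal) \<longlongrightarrow> 2 * sqrt (q - q)) (at_right (ereal q))"
        unfolding ereal_tendsto_simps by (intro tendsto_intros)
      show "(((\<lambda>x. 2 * sqrt (x - q)) \<circ> real_of_ereal) \<longlongrightarrow> 2 * sqrt (b - q)) (at_left (ereal b))"
        unfolding ereal_tendsto_simps by (intro tendsto_intros)
    qed (use b in auto)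
  qed
  then have "set_integrable lborel (einterval q b) (fbar' M H c)"
  proof (rule set_integrable_bound)
    have "fbar' M H c \<in> borel_measurable borel" unfolding fbar'_def by measurable
    then show "set_borel_measurable lborel (einterval q b) (fbar' M H c)"
      unfolding set_borel_measurable_def by measurable
    show "AE x in lborel. x \<in> einterval q b \<longrightarrow>
        norm (fbar' M H c x) \<le> norm (C * (1 / sqrt (x - q)))"
    proof (intro AE_I2 impI)
      fix x assume "x \<in> einterval q b"
      then have x: "q < x" "x < b" by (auto simp: einterval_def)
      have reg: "x \<in> regular_radii M H c" using regular_above_left_end x le by simp
      have "d / 2 * (x - q) \<le> disc M H c x" using near[OF x] x by (simp add: field_simps)
      then have "sqrt (d / 2) * sqrt (x - q) \<le> sqrt (disc M H c x)"
        by (simp flip: real_sqrt_mult)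
      then have "F * (sqrt (d / 2) * sqrt (x - q)) \<le> - flux H c x * sqrt (disc M H c x)"
        using near[OF x] F x d by (intro mult_mono) auto
      also have "\<dots> \<le> disc M H c x - flux H c x * sqrt (disc M H c x)"
        using reg by (simp add: regular_radii_def)
      finally have den: "F * (sqrt (d / 2) * sqrt (x - q)) \<le> disc M H c x - flux H c x * sqrt (disc M H c x)" .
      have "0 < F * (sqrt (d / 2) * sqrt (x - q))" using F d x by simp
      moreover have "x ^ 4 \<le> (2 * M) ^ 4" using near[OF x] x q0 by (intro power_mono) auto
      ultimately have "fbar' M H c x \<le> (2 * M) ^ 4 / (F * (sqrt (d / 2) * sqrt (x - q)))"
        unfolding fbar'_eq_disc using den by (intro frac_le) auto
      moreover have "0 \<le> fbar' M H c x"
        unfolding fbar'_eq_disc using fbar'_denominator_pos[OF reg] by simp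
      ultimately show "norm (fbar' M H c x) \<le> norm (C * (1 / sqrt (x - q)))"
        unfolding C_def using F d x by (simp add: mult.assoc)
    qed
  qed
  then show thesis using that b unfolding q_def einterval_eq by simp
qed

text \<open>Continuity settles everything except a lower end point equal to \<open>left_end\<close>.
  That end point lies in \<open>radii\<close> only as the turning point, where the square root
  singularity is integrable.\<close>

lemma fbar'_interval_integrable:
  assumes "a \<in> radii" "b \<in> radii"
  shows "interval_lebesgue_integrable lborel (ereal a) (ereal b) (fbar' M H c)"
  using assms
proof (induction a b rule: linorder_wlog)
  case (sym a b)
  then show ?case using interval_integrable_endpoints_reverse by blast
next
  case (le a b)
  have cont: "continuous_on {x..y} (fbar' M H c)" if "left_end < x" for x y
    using that by (intro continuous_at_imp_continuous_on ballI isCont_fbar' regular_above_left_end) auto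
  show ?case
  proof (cases "left_end < a")
    case True
    then show ?thesis using le by (intro interval_integrable_continuous_on cont)
  next
    case False
    then have a: "a = left_end" using le left_end_le_radii by force
    then have c: "cH M H < c" using le left_end dom2_bounds(4) by auto
    then have turn: "a = r_turn M H c" using a by (simp add: left_end_def)
    obtain b' where b': "a < b'" "set_integrable lborel {a<..<b'} (fbar' M H c)"
      using fbar'_integrable_near_r_turn[OF c] turn by metis
    have "set_integrable lborel {b'..b} (fbar' M H c)"
      using b' a by (intro borel_integrable_atLeastAtMost' cont) simp
    \<comment> \<open>If \<open>b < b'\<close>, the second piece is empty; the union covers
      \<open>{a<..<b}\<close> in every case.\<close>
    with b'(2) have "set_integrable lborel ({a<..<b'} \<union> {b'..b}) (fbar' M H c)"
      by (rule set_integrable_Un) auto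
    then have "set_integrable lborel {a<..<b} (fbar' M H c)"
      by (rule set_integrable_subset) auto
    then show ?thesis using le by (simp add: interval_lebesgue_integrable_def)
  qed
qed

lemma fbar'_integral_sum:
  assumes "x \<in> radii" "y \<in> radii" "z \<in> radii"
  shows "(LBINT s=x..y. fbar' M H c s) + (LBINT s=y..z. fbar' M H c s) = (LBINT s=x..z. fbar' M H c s)"
proof (rule interval_integral_sum)
  have "min x (min y z) \<in> radii" "max x (max y z) \<in> radii"
    using assms by (auto simp: min_def max_def)
  from fbar'_interval_integrable[OF this]
  show "interval_lebesgue_integrable lborel (min (ereal x) (min (ereal y) (ereal z)))
      (max (ereal x) (max (ereal y) (ereal z))) (fbar' M H c)"
    by (simp add: ereal_min ereal_max)
qed

lemma fbar'_integral_has_derivative: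
  assumes b: "b \<in> radii" and x: "2 * M \<le> x"
  shows "((\<lambda>r. LBINT s=b..r. fbar' M H c s) has_real_derivative fbar' M H c x) (at x)"
proof -
  \<comment> \<open>The base point \<open>b\<close> may be singular, so the integral is rebased at
    \<open>x\<close>. As \<open>m\<close> lies strictly between \<open>left_end\<close> and
    \<open>x\<close>, the integrand is continuous on a two-sided neighbourhood of
    \<open>x\<close>.\<close>
  define m where "m = (left_end + 2 * M) / 2"
  have m: "left_end < m" "m < x" using left_end x by (auto simp: m_def)
  have "continuous_on {m..x + 1} (fbar' M H c)"
    using m by (intro continuous_at_imp_continuous_on ballI isCont_fbar' regular_above_left_end) auto
  then have "((\<lambda>r. LBINT s=x..r. fbar' M H c s) has_vector_derivative fbar' M H c x) (at x within {m..x + 1})"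
    using m by (intro interval_integral_FTC2) auto
  then have "((\<lambda>r. LBINT s=x..r. fbar' M H c s) has_real_derivative fbar' M H c x) (at x)"
    using m by (simp add: at_within_Icc_at has_real_derivative_iff_has_vector_derivative)
  then have "((\<lambda>r. (LBINT s=b..x. fbar' M H c s) + (LBINT s=x..r. fbar' M H c s))
      has_real_derivative fbar' M H c x) (at x)"
    by (auto intro!: derivative_eq_intros)
  then show ?thesis
  proof (rule has_field_derivative_transform_within_open)
    show "(LBINT s=b..x. fbar' M H c s) + (LBINT s=x..r. fbar' M H c s) = (LBINT s=b..r. fbar' M H c s)"
      if "r \<in> {left_end<..}" for r
      using that b x radiiI[of r] by (intro fbar'_integral_sum) auto
  qed (use m in auto)
qed

section \<open>Height functions as integrals of \<open>fbar'\<close>\<close>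

lemma inverse_h_integral:
  assumes "0 < a" "0 < b" "a < 2 * M \<and> b < 2 * M \<or> 2 * M < a \<and> 2 * M < b"
  shows "(LBINT s=a..b. 1 / h M s) = tortoise M b - tortoise M a"
    and "interval_lebesgue_integrable lborel (ereal a) (ereal b) (\<lambda>s. 1 / h M s)"
proof -
  have ne: "0 < s \<and> s \<noteq> 2 * M" if "min a b \<le> s" "s \<le> max a b" for s
    using that assms by (auto simp: min_def max_def split: if_splits)
  have cont: "isCont (\<lambda>s. 1 / h M s) s" if "min a b \<le> s" "s \<le> max a b" for s
    using ne[OF that] h_neq_0[of s M] unfolding h_def by (intro continuous_intros) auto
  show "interval_lebesgue_integrable lborel (ereal a) (ereal b) (\<lambda>s. 1 / h M s)"
    by (intro interval_integrable_isCont cont) auto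
  show "(LBINT s=a..b. 1 / h M s) = tortoise M b - tortoise M a"
  proof (rule interval_integral_FTC_finite)
    show "continuous_on {min a b..max a b} (\<lambda>s. 1 / h M s)"
      using cont by (intro continuous_at_imp_continuous_on) auto
    fix s assume "min a b \<le> s" "s \<le> max a b"
    note s = ne[OF this]
    have "((\<lambda>s. s + 2 * M * ln \<bar>s - 2 * M\<bar>) has_real_derivative 1 / h M s) (at s)"
    proof (cases "s < 2 * M")
      case True
      have "((\<lambda>s. s + 2 * M * ln (2 * M - s)) has_real_derivative 1 / h M s) (at s)"
        using s True by (auto intro!: derivative_eq_intros simp: h_def field_simps)
      then show ?thesis
        by (rule has_field_derivative_transform_within_open[of _ _ _ "{..<2 * M}"]) (use True in auto)
    next
      case False
      have "((\<lambda>s. s + 2 * M * ln (s - 2 * M)) has_real_derivative 1 / h M s) (at s)"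
        using s False by (auto intro!: derivative_eq_intros simp: h_def field_simps)
      then show ?thesis
        by (rule has_field_derivative_transform_within_open[of _ _ _ "{2 * M<..}"]) (use s False in auto)
    qed
    then show "(tortoise M has_vector_derivative 1 / h M s) (at s within {min a b..max a b})"
      unfolding tortoise_def[abs_def] has_real_derivative_iff_has_vector_derivative
      by (rule has_vector_derivative_at_within)
  qed
qed

text \<open>\<open>\<sigma>\<close> is 1 for \<open>f1\<close> and \<open>f2_star\<close>, and -1
  for \<open>f3\<close> and \<open>f2_star2\<close>. Agreement in the open interval suffices, which
  allows the turning point as an end point.\<close>

lemma height_integral:
  assumes ab: "a \<in> radii" "b \<in> radii" "a < 2 * M \<and> b < 2 * M \<or> 2 * M < a \<and> 2 * M < b"
    and f: "\<And>x. min a b < x \<Longrightarrow> x < max a b \<Longrightarrow> f x = \<sigma> * (fbar' M H c x - 1 / h M x)"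
  shows "(LBINT x=a..b. f x) = \<sigma> * ((LBINT x=a..b. fbar' M H c x) - (tortoise M b - tortoise M a))"
proof -
  have pos: "0 < r" if "r \<in> radii" for r
  proof (cases "left_end < r")
    case False
    then have "r = left_end" using that left_end_le_radii by force
    then have "cH M H < c" using that left_end dom2_bounds(4) by auto
    then show ?thesis
      using \<open>r = left_end\<close> r_turn_properties(1)[OF M_pos _ c_less] rH_properties(1)[OF M_pos, of H]
      by (simp add: left_end_def)
  qed (use left_end in simp)
  have "(LBINT x=a..b. f x) = (LBINT x=a..b. \<sigma> * (fbar' M H c x - 1 / h M x))"
  proof (rule interval_integral_cong)
    show "f x = \<sigma> * (fbar' M H c x - 1 / h M x)"
      if "x \<in> einterval (min (ereal a) (ereal b)) (max (ereal a) (ereal b))" for x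
      using that f[of x] by (auto simp: einterval_def min_def max_def split: if_splits)
  qed
  also have "\<dots> = \<sigma> * ((LBINT x=a..b. fbar' M H c x) - (LBINT x=a..b. 1 / h M x))"
    using fbar'_interval_integrable[OF ab(1,2)] inverse_h_integral(2)[OF pos pos ab(3)] ab by simp
  finally show ?thesis using inverse_h_integral(1)[OF pos pos ab(3)] ab by simp
qed

text \<open>Both terms on the left diverge at \<open>2 * M\<close>, but the right-hand side is
  continuous there.\<close>

lemma f1_ingoing:
  assumes "2 * M < b" "2 * M < r"
  shows "f1 M H c b k r + tortoise M r = k + tortoise M b + (LBINT s=b..r. fbar' M H c s)"
proof -
  have "(LBINT x=b..r. l1 M H c x / h M x * (1 / sqrt (1 + (l1 M H c x)\<^sup>2)))
      = 1 * ((LBINT x=b..r. fbar' M H c x) - (tortoise M r - tortoise M b))"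
  proof (rule height_integral)
    fix x assume "min b r < x"
    then have "2 * M < x" using assms by (simp add: min_def split: if_splits)
    then show "l1 M H c x / h M x * (1 / sqrt (1 + (l1 M H c x)\<^sup>2)) = 1 * (fbar' M H c x - 1 / h M x)"
      using f1_integrand[OF M_pos regular_exterior, of x] by simp
  qed (use assms in auto)
  then show ?thesis by (simp add: f1_def)
qed

lemma f3_outgoing:
  assumes "2 * M < b" "2 * M < r"
  shows "f3 M H c b k r - tortoise M r = k - tortoise M b - (LBINT s=b..r. fbar' M H c s)"
proof -
  have "(LBINT x=b..r. l3 M H c x / h M x * (1 / sqrt (1 + (l3 M H c x)\<^sup>2)))
      = - 1 * ((LBINT x=b..r. fbar' M H c x) - (tortoise M r - tortoise M b))"
  proof (rule height_integral)
    fix x assume "min b r < x"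
    then have "2 * M < x" using assms by (simp add: min_def split: if_splits)
    then show "l3 M H c x / h M x * (1 / sqrt (1 + (l3 M H c x)\<^sup>2)) = - 1 * (fbar' M H c x - 1 / h M x)"
      using f1_integrand[OF M_pos regular_exterior, of x] by (simp add: l3_def)
  qed (use assms in auto)
  then show ?thesis by (simp add: f3_def)
qed

lemma between_dom2:
  assumes "b \<in> dom2 M H c" "r \<in> dom2 M H c" "min b r < x" "x < max b r"
  shows "x \<in> regular_radii M H c" "x < 2 * M"
proof -
  have "left_end < x"
    using assms(3) dom2_bounds(1)[OF assms(1)] dom2_bounds(1)[OF assms(2)] by linarith
  then show "x \<in> regular_radii M H c" by (rule regular_above_left_end)
  show "x < 2 * M"
    using assms(4) dom2_bounds(2)[OF assms(1)] dom2_bounds(2)[OF assms(2)] by linarith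
qed

lemma f2_star_ingoing:
  assumes "b \<in> dom2 M H c" "r \<in> dom2 M H c"
  shows "f2_star M H c b k r + tortoise M r = k + tortoise M b + (LBINT s=b..r. fbar' M H c s)"
proof -
  have "(LBINT x=b..r. 1 / (- h M x) * sqrt ((l2 M H c x)\<^sup>2 / ((l2 M H c x)\<^sup>2 - 1)))
      = 1 * ((LBINT x=b..r. fbar' M H c x) - (tortoise M r - tortoise M b))"
  proof (rule height_integral)
    fix x assume x: "min b r < x" "x < max b r"
    then show "1 / (- h M x) * sqrt ((l2 M H c x)\<^sup>2 / ((l2 M H c x)\<^sup>2 - 1)) = 1 * (fbar' M H c x - 1 / h M x)"
      using f2_star_integrand[OF between_dom2[OF assms x]] by simp
  qed (use assms dom2_bounds(2) in auto)
  then show ?thesis by (simp add: f2_star_def)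
qed

lemma f2_star2_outgoing:
  assumes "b \<in> dom2 M H c" "r \<in> dom2 M H c"
  shows "f2_star2 M H c b k r - tortoise M r = k - tortoise M b - (LBINT s=b..r. fbar' M H c s)"
proof -
  have "(LBINT x=b..r. 1 / h M x * sqrt ((l2 M H c x)\<^sup>2 / ((l2 M H c x)\<^sup>2 - 1)))
      = - 1 * ((LBINT x=b..r. fbar' M H c x) - (tortoise M r - tortoise M b))"
  proof (rule height_integral)
    fix x assume x: "min b r < x" "x < max b r"
    then show "1 / h M x * sqrt ((l2 M H c x)\<^sup>2 / ((l2 M H c x)\<^sup>2 - 1)) = - 1 * (fbar' M H c x - 1 / h M x)"
      using f2_star_integrand[OF between_dom2[OF assms x]] by simp
  qed (use assms dom2_bounds(2) in auto)
  then show ?thesis by (simp add: f2_star2_def)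
qed

section \<open>Matching the constants at the two horizons\<close>

lemma isCont_fbar'_integral:
  "b \<in> radii \<Longrightarrow> isCont (\<lambda>r :: real. LBINT s=b..r. fbar' M H c s) (2 * M)"
  using DERIV_isCont[OF fbar'_integral_has_derivative] by blast

text \<open>The \<open>V\<close> coordinate of the limiting sphere is computed from both sides, with
  integrals ending at \<open>2 * M\<close>; additivity merges them into one integral from
  \<open>r2\<close> to \<open>r1\<close>.\<close>

lemma connects_I_II:
  assumes r1: "2 * M < r1" and r2: "r2 \<in> dom2 M H c" and r2': "r2' \<in> dom2 M H c"
    and con: "connects_smoothly M horizon_I_II (\<Sigma>1 M H c r1 k1) (\<Sigma>2 M H c r2 k2 r2' k2')"
  shows "k2 + tortoise M r2 = k1 + tortoise M r1 - (LBINT r=r2..r1. fbar' M H c r)"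
proof -
  let ?I = "\<lambda>a b. LBINT s=ereal a..ereal b. fbar' M H c s"
  obtain P \<omega> where P: "P \<in> horizon_I_II"
    and c1: "(P, \<omega>) \<in> closure (\<Sigma>1 M H c r1 k1)" and c2: "(P, \<omega>) \<in> closure (\<Sigma>2 M H c r2 k2 r2' k2')"
    \<comment> \<open>This vector picks out \<open>U\<close>, positive in region I and negative in
      region II.\<close>
    by (rule connects_smoothly_closure[OF con, of "(1, 0)"])
      (auto simp: horizon_I_II_def \<Sigma>1_def \<Sigma>2_def graph_in_def region_I_def region_II_def zero_prod_def split: if_splits)
  obtain V0 where P0: "P = (0, V0)" using P by (auto simp: horizon_I_II_def)
  have "\<bar>V0\<bar> = exp ((k1 + tortoise M r1 + ?I r1 (2 * M)) / (4 * M))"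
    using c1[unfolded \<Sigma>1_def P0] r1 f1_ingoing
    by (intro closure_graph_in_ingoing[OF M_pos, where F = "\<lambda>r. k1 + tortoise M r1 + ?I r1 r"])
      (auto simp: region_I_def intro!: continuous_intros isCont_fbar'_integral)
  \<comment> \<open>On the second branch \<open>t - r\<close> in tortoise form stays finite at the
    horizon, which would force \<open>U \<noteq> 0\<close> at \<open>P\<close>.\<close>
  moreover have "(P, \<omega>) \<notin> closure (graph_in M region_II (dom2 M H c) (f2_star2 M H c r2' k2'))"
  proof
    assume "(P, \<omega>) \<in> closure (graph_in M region_II (dom2 M H c) (f2_star2 M H c r2' k2'))"
    then have "\<bar>0\<bar> = exp (- (k2' - tortoise M r2' - ?I r2' (2 * M)) / (4 * M))"
      unfolding P0 using r2' f2_star2_outgoing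
      by (intro closure_graph_in_outgoing[OF M_pos, where F = "\<lambda>r. k2' - tortoise M r2' - ?I r2' r"])
        (auto simp: region_II_def intro!: continuous_intros isCont_fbar'_integral)
    then show False by simp
  qed
  then have "(P, \<omega>) \<in> closure (graph_in M region_II (dom2 M H c) (f2_star M H c r2 k2))"
    using c2 unfolding \<Sigma>2_def by (auto split: if_splits)
  then have "\<bar>V0\<bar> = exp ((k2 + tortoise M r2 + ?I r2 (2 * M)) / (4 * M))"
    unfolding P0 using r2 f2_star_ingoing
    by (intro closure_graph_in_ingoing[OF M_pos, where F = "\<lambda>r. k2 + tortoise M r2 + ?I r2 r"])
      (auto simp: region_II_def intro!: continuous_intros isCont_fbar'_integral)
  ultimately have "k1 + tortoise M r1 + ?I r1 (2 * M) = k2 + tortoise M r2 + ?I r2 (2 * M)"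
    using M_pos by simp
  moreover have "?I r2 r1 + ?I r1 (2 * M) = ?I r2 (2 * M)"
    using r1 r2 by (intro fbar'_integral_sum) auto
  ultimately show ?thesis by linarith
qed

text \<open>Here \<open>V\<close> is the coordinate that changes sign. Only the second branch can
  reach \<open>V = 0\<close>, so its constants \<open>k2'\<close> and \<open>r2'\<close> enter the
  relation.\<close>

lemma connects_II_I':
  assumes r3: "2 * M < r3" and r2: "r2 \<in> dom2 M H c" and r2': "r2' \<in> dom2 M H c"
    and con: "connects_smoothly M horizon_II_I' (\<Sigma>2 M H c r2 k2 r2' k2') (\<Sigma>3 M H c r3 k3)"
  shows "k3 - tortoise M r3 = k2' - tortoise M r2' - (LBINT r=r2'..r3. fbar' M H c r)"
proof -
  let ?I = "\<lambda>a b. LBINT s=ereal a..ereal b. fbar' M H c s"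
  obtain P \<omega> where P: "P \<in> horizon_II_I'"
    and c2: "(P, \<omega>) \<in> closure (\<Sigma>2 M H c r2 k2 r2' k2')" and c3: "(P, \<omega>) \<in> closure (\<Sigma>3 M H c r3 k3)"
    by (rule connects_smoothly_closure[OF con, of "(0, 1)"])
      (auto simp: horizon_II_I'_def \<Sigma>3_def \<Sigma>2_def graph_in_def region_I'_def region_II_def zero_prod_def split: if_splits)
  obtain U0 where P0: "P = (U0, 0)" using P by (auto simp: horizon_II_I'_def)
  have "\<bar>U0\<bar> = exp (- (k3 - tortoise M r3 - ?I r3 (2 * M)) / (4 * M))"
    using c3[unfolded \<Sigma>3_def P0] r3 f3_outgoing
    by (intro closure_graph_in_outgoing[OF M_pos, where F = "\<lambda>r. k3 - tortoise M r3 - ?I r3 r"])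
      (auto simp: region_I'_def intro!: continuous_intros isCont_fbar'_integral)
  moreover have "(P, \<omega>) \<notin> closure (graph_in M region_II (dom2 M H c) (f2_star M H c r2 k2))"
  proof
    assume "(P, \<omega>) \<in> closure (graph_in M region_II (dom2 M H c) (f2_star M H c r2 k2))"
    then have "\<bar>0\<bar> = exp ((k2 + tortoise M r2 + ?I r2 (2 * M)) / (4 * M))"
      unfolding P0 using r2 f2_star_ingoing
      by (intro closure_graph_in_ingoing[OF M_pos, where F = "\<lambda>r. k2 + tortoise M r2 + ?I r2 r"])
        (auto simp: region_II_def intro!: continuous_intros isCont_fbar'_integral)
    then show False by simp
  qed
  \<comment> \<open>For \<open>c \<le> cH M H\<close> there is no second branch, and the hypothesis
    is then contradictory.\<close>
  then have "(P, \<omega>) \<in> closure (graph_in M region_II (dom2 M H c) (f2_star2 M H c r2' k2'))"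
    using c2 unfolding \<Sigma>2_def by (auto split: if_splits)
  then have "\<bar>U0\<bar> = exp (- (k2' - tortoise M r2' - ?I r2' (2 * M)) / (4 * M))"
    unfolding P0 using r2' f2_star2_outgoing
    by (intro closure_graph_in_outgoing[OF M_pos, where F = "\<lambda>r. k2' - tortoise M r2' - ?I r2' r"])
      (auto simp: region_II_def intro!: continuous_intros isCont_fbar'_integral)
  ultimately have "k3 - tortoise M r3 - ?I r3 (2 * M) = k2' - tortoise M r2' - ?I r2' (2 * M)"
    using M_pos by simp
  moreover have "?I r2' r3 + ?I r3 (2 * M) = ?I r2' (2 * M)"
    using r3 r2' by (intro fbar'_integral_sum) auto
  ultimately show ?thesis by linarith
qed

lemma f1_has_derivative:
  assumes "2 * M < b" "2 * M < r"
  shows "(f1 M H c b k has_real_derivative fbar' M H c r - 1 / h M r) (at r)"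
proof -
  have "(tortoise M has_real_derivative 1 / h M r) (at r)"
  proof -
    have "((\<lambda>s. s + 2 * M * ln (s - 2 * M)) has_real_derivative 1 / h M r) (at r)"
      using assms M_pos by (auto intro!: derivative_eq_intros simp: h_def field_simps)
    then show ?thesis
      by (rule has_field_derivative_transform_within_open[of _ _ _ "{2 * M<..}"])
        (use assms in \<open>auto simp: tortoise_def\<close>)
  qed
  then have "((\<lambda>r. (k + tortoise M b + (LBINT s=b..r. fbar' M H c s)) - tortoise M r)
      has_real_derivative fbar' M H c r - 1 / h M r) (at r)"
    using fbar'_integral_has_derivative[of b r] assms by (auto intro!: derivative_eq_intros)
  then show ?thesis
    by (rule has_field_derivative_transform_within_open[of _ _ _ "{2 * M<..}"])
      (use assms in \<open>auto simp flip: f1_ingoing\<close>)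
qed

end

theorem theorem2:
  fixes M H c1 cb1 r1 :: real
  assumes "M > 0"
    and "c1 < - 8 * M ^ 3 * H"
    and "r1 > 2 * M"
    and "r1 + 2 * M * ln \<bar>r1 - 2 * M\<bar> = 0"
  shows
    "(\<forall>r>2 * M. f1 M H c1 r1 cb1 differentiable (at r) \<and>
        deriv (f1 M H c1 r1 cb1) r + 1 / h M r = fbar' M H c1 r) \<and>
     (\<forall>r2\<in>dom2 M H c1. interval_lebesgue_integrable lborel r2 r1 (fbar' M H c1)) \<and>
     (\<forall>r2\<in>dom2 M H c1. \<forall>r2'\<in>dom2 M H c1. \<forall>cb2 cb2'.
        branches_match M H c1 r2 cb2 r2' cb2' \<longrightarrow>
        connects_smoothly M horizon_I_II (\<Sigma>1 M H c1 r1 cb1) (\<Sigma>2 M H c1 r2 cb2 r2' cb2') \<longrightarrow>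
        cb2 = cb1 - (LBINT r=r2..r1. fbar' M H c1 r) - (r2 + 2 * M * ln \<bar>r2 - 2 * M\<bar>)) \<and>
     (cH M H < c1 \<longrightarrow>
        (\<forall>r'' r2 r2' r3 cb2 cb2' cb3.
           r'' = r_turn M H c1 \<longrightarrow> r2 = r'' \<longrightarrow> r2' = r'' \<longrightarrow> cb2' = cb2 \<longrightarrow> r3 = r1 \<longrightarrow>
           connects_smoothly M horizon_I_II (\<Sigma>1 M H c1 r1 cb1) (\<Sigma>2 M H c1 r2 cb2 r2' cb2') \<longrightarrow>
           connects_smoothly M horizon_II_I' (\<Sigma>2 M H c1 r2 cb2 r2' cb2') (\<Sigma>3 M H c1 r3 cb3) \<longrightarrow>
           cb3 = cb2 - (LBINT r=r''..r3. fbar' M H c1 r)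
                     - (r'' + 2 * M * ln \<bar>r'' - 2 * M\<bar>) \<and>
           cb3 = cb1 - 2 * (LBINT r=r''..r1. fbar' M H c1 r)
                     - 2 * (r'' + 2 * M * ln \<bar>r'' - 2 * M\<bar>)))"
proof -
  interpret cmc_family M H c1 by standard (use assms in auto)
  \<comment> \<open>The normalisation of the base point removes the boundary term at
    \<open>r1\<close> from both relations.\<close>
  have r1: "tortoise M r1 = 0" using assms(4) by (simp add: tortoise_def)
  have part2: "cb2 = cb1 - (LBINT r=r2..r1. fbar' M H c1 r) - tortoise M r2"
    if "r2 \<in> dom2 M H c1" "r2' \<in> dom2 M H c1"
      "connects_smoothly M horizon_I_II (\<Sigma>1 M H c1 r1 cb1) (\<Sigma>2 M H c1 r2 cb2 r2' cb2')"
    for r2 r2' cb2 cb2'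
    using connects_I_II[OF assms(3) that] r1 by simp
  have part3: "cb3 = cb2' - (LBINT r=r2'..r1. fbar' M H c1 r) - tortoise M r2'"
    if "r2 \<in> dom2 M H c1" "r2' \<in> dom2 M H c1"
      "connects_smoothly M horizon_II_I' (\<Sigma>2 M H c1 r2 cb2 r2' cb2') (\<Sigma>3 M H c1 r1 cb3)"
    for r2 r2' cb2 cb2' cb3
    using connects_II_I'[OF assms(3) that] r1 by simp
  have turn: "r_turn M H c1 \<in> dom2 M H c1" if "cH M H < c1"
    using that dom2_bounds(4) by (simp add: left_end_def)
  have "f1 M H c1 r1 cb1 differentiable (at r) \<and>
      deriv (f1 M H c1 r1 cb1) r + 1 / h M r = fbar' M H c1 r" if "2 * M < r" for r
    using f1_has_derivative[OF assms(3) that, of cb1] DERIV_imp_deriv[OF f1_has_derivative[OF assms(3) that, of cb1]]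
    by (auto simp: real_differentiable_def)
  moreover have "interval_lebesgue_integrable lborel r2 r1 (fbar' M H c1)" if "r2 \<in> dom2 M H c1" for r2
    using that assms(3) by (intro fbar'_interval_integrable) auto
  moreover have "cb3 = cb2 - (LBINT r=r_turn M H c1..r1. fbar' M H c1 r) - tortoise M (r_turn M H c1) \<and>
      cb3 = cb1 - 2 * (LBINT r=r_turn M H c1..r1. fbar' M H c1 r) - 2 * tortoise M (r_turn M H c1)"
    if "cH M H < c1"
      "connects_smoothly M horizon_I_II (\<Sigma>1 M H c1 r1 cb1)
        (\<Sigma>2 M H c1 (r_turn M H c1) cb2 (r_turn M H c1) cb2)"
      "connects_smoothly M horizon_II_I' (\<Sigma>2 M H c1 (r_turn M H c1) cb2 (r_turn M H c1) cb2)
        (\<Sigma>3 M H c1 r1 cb3)"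
    for cb2 cb3
    \<comment> \<open>With both base points at the turning point and equal constants, the two
      relations share the same integral and boundary term; inserting the first into the second
      doubles them.\<close>
    using part2[OF turn turn that(2)] part3[OF turn turn that(3)] that(1) by auto
  ultimately show ?thesis using part2 unfolding tortoise_def by blast
qed

end
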